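(* Let $\mu$ be a probability distribution on $\Omega=\Lambda^N$ and let $A=(a_{ij})_{i,j\le N}$ be a Dobrushin interdependence matrix of $\mu$. Consider the Glauber dynamics Markov chain with systemic scan on $\Omega$: in each step, go through the coordinates $1,2,\ldots,N$ in this order, and replace each coordinate $i$ in turn by an independent draw from the conditional distribution $\mu_i(\cdot|x_{-i})$ given the current values of the other coordinates. For $1\le i\le N$ let $B_i$ be the $N\times N$ matrix equal to the identity matrix except for its $i$-th row, which equals the $i$-th row of $A$, and let $B=B_N\cdot B_{N-1}\cdots B_1$. Then for every integer $k\ge1$, $$\kappa_k\ge1-\|B^k\|_1 .$$
   Context: $(\Lambda,d_\Lambda)$ is a Polish metric space, $\Omega=\Lambda^N$ with metric $d(x,y)=\sum_{i=1}^N d_\Lambda(x_i,y_i)$, and $x_{-i}=(x_1,\ldots,x_{i-1},x_{i+1},\ldots,x_N)$. For $X\sim\mu$, $\mu_i(\cdot|x_{-i})$ denotes the conditional distribution of $X_i$ given $X_{-i}=x_{-i}$ (a version defined for all $x$). $A=(a_{ij})$ is a Dobrushin interdependence matrix of $\mu$ if $a_{ii}=0$ for all $i$ and for all $x,y\in\Omega$ and all $i$, $W_1(\mu_i(\cdot|x_{-i}),\mu_i(\cdot|y_{-i}))\le\sum_{j=1}^N a_{ij}\,d_\Lambda(x_j,y_j)$, with $W_1$ the Wasserstein distance for $d_\Lambda$ (its entries are nonnegative). $\|\cdot\|_1$ is the matrix norm induced by the $\ell^1$ norm on column vectors (maximal column sum of absolute values). With $P$ the kernel of the chain (one step = one full sweep;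 assumed to satisfy $W_1(\delta_x,P_x)<\infty$ for all $x$) and $P^k_x$ the law after $k$ steps from $x$, $W_1(\mu_1,\mu_2)=\inf\mathbb{E}(d(X,Y))$ over couplings of $\mu_1,\mu_2$ on $(\Omega,d)$; $\kappa_k(x,y)=1-W_1(P^k_x,P^k_y)/d(x,y)$ for $x\ne y$, $\kappa_k(x,x)=1$, $\kappa_k=\inf_{x,y}\kappa_k(x,y)$. *)

theory Defs
  imports "HOL-Probability.Probability" "Jordan_Normal_Form.Matrix"
begin

text \<open>
  Coordinates are numbered \<open>0, \<dots>, N - 1\<close>. A configuration is an extensional function on
  \<open>{..<N}\<close>, so that the space of the product measure below is exactly \<open>\<Lambda>\<^sup>N\<close>; as \<open>\<Lambda>\<close> is second
  countable, its product \<open>\<sigma>\<close>-algebra is the Borel \<open>\<sigma>\<close>-algebra of \<open>\<Lambda>\<^sup>N\<close>.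
\<close>

definition config :: "nat \<Rightarrow> (nat \<Rightarrow> 'a::polish_space) measure" where
  "config N = (\<Pi>\<^sub>M i\<in>{..<N}. borel)"

definition config_dist :: "nat \<Rightarrow> (nat \<Rightarrow> 'a::polish_space) \<Rightarrow> (nat \<Rightarrow> 'a) \<Rightarrow> real" where
  "config_dist N x y = (\<Sum>i<N. dist (x i) (y i))"

definition others :: "nat \<Rightarrow> nat \<Rightarrow> nat set" where
  "others N i = {..<N} - {i}"

definition config_except :: "nat \<Rightarrow> nat \<Rightarrow> (nat \<Rightarrow> 'a::polish_space) measure" where
  "config_except N i = (\<Pi>\<^sub>M j\<in>others N i. borel)"

text \<open>The point \<open>x\<^bsub>-i\<^esub>\<close>.\<close>

definition drop_coord :: "nat \<Rightarrow> nat \<Rightarrow> (nat \<Rightarrow> 'a) \<Rightarrow> nat \<Rightarrow> 'a" where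
  "drop_coord N i x = restrict x (others N i)"



definition couplings :: "'a measure \<Rightarrow> 'b measure \<Rightarrow> ('a \<times> 'b) measure set" where
  "couplings \<mu> \<nu> =
     {\<gamma>. sets \<gamma> = sets (\<mu> \<Otimes>\<^sub>M \<nu>) \<and> distr \<gamma> \<mu> fst = \<mu> \<and> distr \<gamma> \<nu> snd = \<nu>}"

definition wasserstein1 ::
    "('a \<Rightarrow> 'a \<Rightarrow> real) \<Rightarrow> 'a measure \<Rightarrow> 'a measure \<Rightarrow> ennreal" where
  "wasserstein1 d \<mu> \<nu> =
     (INF \<gamma>\<in>couplings \<mu> \<nu>. \<integral>\<^sup>+ p. ennreal (d (fst p) (snd p)) \<partial>\<gamma>)"

fun kernel_power :: "'a measure \<Rightarrow> ('a \<Rightarrow> 'a measure) \<Rightarrow> nat \<Rightarrow> 'a \<Rightarrow> 'a measure" where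
  "kernel_power M P 0 x = return M x"
| "kernel_power M P (Suc k) x = kernel_power M P k x \<bind> P"

text \<open>
  Curvature is extended-real valued: it is \<open>-\<infinity>\<close> where the Wasserstein distance is infinite,
  and the infimum over all pairs of points always exists.
\<close>

definition curvature_at ::
    "'a measure \<Rightarrow> ('a \<Rightarrow> 'a \<Rightarrow> real) \<Rightarrow> ('a \<Rightarrow> 'a measure) \<Rightarrow> nat \<Rightarrow> 'a \<Rightarrow> 'a \<Rightarrow> ereal" where
  "curvature_at M d P k x y =
     (if x = y then 1
      else 1 - enn2ereal (wasserstein1 d (kernel_power M P k x) (kernel_power M P k y))
                 / ereal (d x y))"

definition curvature ::
    "'a measure \<Rightarrow> ('a \<Rightarrow> 'a \<Rightarrow> real) \<Rightarrow> ('a \<Rightarrow> 'a measure) \<Rightarrow> nat \<Rightarrow> ereal" where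
  "curvature M d P k = (INF x\<in>space M. INF y\<in>space M. curvature_at M d P k x y)"



text \<open>
  \<open>K i z\<close> is the conditional distribution of coordinate \<open>i\<close> given that the remaining coordinates
  are \<open>z\<close>: a Markov kernel, defined for all \<open>z\<close>, that disintegrates \<open>\<mu>\<close>.
\<close>

definition conditional_distributions ::
    "nat \<Rightarrow> (nat \<Rightarrow> 'a::polish_space) measure \<Rightarrow> (nat \<Rightarrow> (nat \<Rightarrow> 'a) \<Rightarrow> 'a measure) \<Rightarrow> bool" where
  "conditional_distributions N \<mu> K \<longleftrightarrow>
     (\<forall>i<N. K i \<in> config_except N i \<rightarrow>\<^sub>M prob_algebra borel \<and>
       (\<forall>C\<in>sets (config_except N i). \<forall>E\<in>sets borel.
          emeasure \<mu> {x \<in> space \<mu>. drop_coord N i x \<in> C \<and> x i \<in> E}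
            = (\<integral>\<^sup>+z\<in>C. emeasure (K i z) E \<partial>distr \<mu> (config_except N i) (drop_coord N i))))"

definition dobrushin_matrix ::
    "nat \<Rightarrow> (nat \<Rightarrow> (nat \<Rightarrow> 'a::polish_space) \<Rightarrow> 'a measure) \<Rightarrow> real mat \<Rightarrow> bool" where
  "dobrushin_matrix N K A \<longleftrightarrow>
     A \<in> carrier_mat N N \<and>
     (\<forall>i<N. \<forall>j<N. 0 \<le> A $$ (i, j)) \<and>
     (\<forall>i<N. A $$ (i, i) = 0) \<and>
     (\<forall>x\<in>space (config N). \<forall>y\<in>space (config N). \<forall>i<N.
        wasserstein1 dist (K i (drop_coord N i x)) (K i (drop_coord N i y))
          \<le> ennreal (\<Sum>j<N. A $$ (i, j) * dist (x j) (y j)))"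

definition glauber_update ::
    "nat \<Rightarrow> (nat \<Rightarrow> (nat \<Rightarrow> 'a::polish_space) \<Rightarrow> 'a measure) \<Rightarrow> nat
      \<Rightarrow> (nat \<Rightarrow> 'a) \<Rightarrow> (nat \<Rightarrow> 'a) measure" where
  "glauber_update N K i x = distr (K i (drop_coord N i x)) (config N) (\<lambda>a. x(i := a))"

text \<open>One step of the chain: coordinate \<open>0\<close> is updated first, coordinate \<open>N - 1\<close> last.\<close>

definition systemic_scan ::
    "nat \<Rightarrow> (nat \<Rightarrow> (nat \<Rightarrow> 'a::polish_space) \<Rightarrow> 'a measure)
      \<Rightarrow> (nat \<Rightarrow> 'a) \<Rightarrow> (nat \<Rightarrow> 'a) measure" where
  "systemic_scan N K x =
     foldl (\<lambda>m i. m \<bind> glauber_update N K i) (return (config N) x) [0..<N]"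



definition update_matrix :: "nat \<Rightarrow> real mat \<Rightarrow> nat \<Rightarrow> real mat" where
  "update_matrix N A i =
     mat N N (\<lambda>(r, c). if r = i then A $$ (i, c) else 1\<^sub>m N $$ (r, c))"

text \<open>The product with the factor of index \<open>N - 1\<close> leftmost and that of index \<open>0\<close> rightmost.\<close>

definition scan_matrix :: "nat \<Rightarrow> real mat \<Rightarrow> real mat" where
  "scan_matrix N A = foldl (\<lambda>M i. update_matrix N A i * M) (1\<^sub>m N) [0..<N]"

definition vec_norm1 :: "real vec \<Rightarrow> real" where
  "vec_norm1 v = (\<Sum>i<dim_vec v. \<bar>vec_index v i\<bar>)"

definition mat_norm1 :: "real mat \<Rightarrow> real" where
  "mat_norm1 A = (SUP v\<in>{v \<in> carrier_vec (dim_col A). vec_norm1 v \<le> 1}. vec_norm1 (A *\<^sub>v v))"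

lemma vec_norm1_mult_mat_vec:
  assumes "v \<in> carrier_vec (dim_col A)"
  shows "vec_norm1 (A *\<^sub>v v)
    \<le> (\<Sum>j<dim_col A. (\<Sum>i<dim_row A. \<bar>A $$ (i, j)\<bar>) * \<bar>vec_index v j\<bar>)"
proof -
  have "vec_norm1 (A *\<^sub>v v) = (\<Sum>i<dim_row A. \<bar>\<Sum>j<dim_col A. A $$ (i, j) * vec_index v j\<bar>)"
    using assms by (simp add: vec_norm1_def scalar_prod_def lessThan_atLeast0)
  also have "\<dots> \<le> (\<Sum>i<dim_row A. \<Sum>j<dim_col A. \<bar>A $$ (i, j)\<bar> * \<bar>vec_index v j\<bar>)"
    by (intro sum_mono order_trans[OF sum_abs]) (simp add: abs_mult)
  also have "\<dots> = (\<Sum>j<dim_col A. (\<Sum>i<dim_row A. \<bar>A $$ (i, j)\<bar>) * \<bar>vec_index v j\<bar>)"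
    by (subst sum.swap) (simp add: sum_distrib_right)
  finally show ?thesis .
qed

lemma mat_norm1_eq_Max_col_sum:
  assumes "0 < dim_col A"
  shows "mat_norm1 A = Max ((\<lambda>j. \<Sum>i<dim_row A. \<bar>A $$ (i, j)\<bar>) ` {..<dim_col A})"
    (is "_ = Max (?s ` _)")
  unfolding mat_norm1_def
proof (rule cSup_eq_maximum)
  have "Max (?s ` {..<dim_col A}) \<in> ?s ` {..<dim_col A}"
    using assms by (intro Max_in) auto
  then obtain j where j: "j < dim_col A" "Max (?s ` {..<dim_col A}) = ?s j"
    by auto
  have "vec_norm1 (unit_vec (dim_col A) j) = 1"
    using j(1) by (simp add: vec_norm1_def unit_vec_def if_distrib[of abs] cong: if_cong)
  moreover have "vec_norm1 (A *\<^sub>v unit_vec (dim_col A) j) = ?s j"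
    using j(1) by (auto simp: vec_norm1_def intro!: sum.cong)
  ultimately show "Max (?s ` {..<dim_col A}) \<in>
      (\<lambda>v. vec_norm1 (A *\<^sub>v v)) ` {v \<in> carrier_vec (dim_col A). vec_norm1 v \<le> 1}"
    using j(2) by (auto intro!: image_eqI[of _ _ "unit_vec (dim_col A) j"])
next
  fix r assume "r \<in> (\<lambda>v. vec_norm1 (A *\<^sub>v v)) ` {v \<in> carrier_vec (dim_col A). vec_norm1 v \<le> 1}"
  then obtain v where v: "v \<in> carrier_vec (dim_col A)" "vec_norm1 v \<le> 1"
    and r: "r = vec_norm1 (A *\<^sub>v v)" by auto
  let ?m = "Max (?s ` {..<dim_col A})"
  have "?s 0 \<le> ?m" using assms by (intro Max_ge) auto
  moreover have "0 \<le> ?s 0" by (simp add: sum_nonneg)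
  ultimately have m0: "0 \<le> ?m" by linarith
  have "r \<le> (\<Sum>j<dim_col A. ?s j * \<bar>vec_index v j\<bar>)"
    using vec_norm1_mult_mat_vec[OF v(1)] r by simp
  also have "\<dots> \<le> (\<Sum>j<dim_col A. ?m * \<bar>vec_index v j\<bar>)"
    by (intro sum_mono mult_right_mono Max_ge) auto
  also have "\<dots> = ?m * vec_norm1 v"
    using v(1) by (simp add: vec_norm1_def sum_distrib_left)
  also have "\<dots> \<le> ?m"
    using m0 v(2) by (simp add: mult_left_le)
  finally show "r \<le> ?m" .
qed

end

theory Submission
  imports Defs
begin

text \<open>
  For a coupling of \<open>X\<close> and \<open>Y\<close> track the vector \<open>v\<^sub>j = E d(X\<^sub>j, Y\<^sub>j)\<close>. Updating coordinate \<open>i\<close>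
  of both with a near-optimal coupling of the two conditional distributions leaves the other entries
  unchanged and replaces \<open>v\<^sub>i\<close> by at most \<open>\<Sum>\<^sub>j a\<^sub>i\<^sub>j v\<^sub>j + \<epsilon>\<close>, that is, \<open>v\<close> by \<open>B\<^sub>i v\<close> up to \<open>\<epsilon>\<close>.
  A full sweep multiplies by \<open>B\<close>, and \<open>k\<close> sweeps from \<open>x\<close> and \<open>y\<close> give
  \<open>W\<^sub>1 \<le> \<parallel>B\<^sup>k\<parallel>\<^sub>1 d(x, y)\<close>.

  The near-optimal couplings must depend measurably on the pair of current states. Averaging a
  coupling over the cells of a fine countable partition gives it a density with respect to the
  product measure that is constant on products of cells; rounding this density down to a dyadic
  one with finitely many nonzero values, and filling up the missing mass by a product measure,
  leaves only countably many candidates, and the first good candidate is a measurable choice.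
  The filled-up mass costs little because the conditional distributions have finite first moments:
  coordinate \<open>i\<close> of one sweep from \<open>x\<close> is a mixture of them, and \<open>W\<^sub>1(\<delta>\<^sub>x, P\<^sub>x) < \<infinity>\<close>.
\<close>

subsection \<open>Couplings with a step density\<close>

text \<open>A matrix \<open>U\<close> indexed by labels encodes the measure with density
  \<open>U (f a) (g b)\<close> with respect to the product of \<mu> and \<nu>. Read at
  \<open>f a\<close>, \<open>row_mass\<close> is the density of its first marginal with respect to
  \<mu>; \<open>col_mass\<close> is the same for the second marginal and \<open>total_mass\<close>
  its mass.\<close>

definition row_mass :: "('b \<Rightarrow> nat) \<Rightarrow> (nat \<Rightarrow> nat \<Rightarrow> ennreal) \<Rightarrow> 'b measure \<Rightarrow> nat \<Rightarrow> ennreal" where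
  "row_mass g U \<nu> k = (\<integral>\<^sup>+b. U k (g b) \<partial>\<nu>)"

definition col_mass :: "('a \<Rightarrow> nat) \<Rightarrow> (nat \<Rightarrow> nat \<Rightarrow> ennreal) \<Rightarrow> 'a measure \<Rightarrow> nat \<Rightarrow> ennreal" where
  "col_mass f U \<mu> l = (\<integral>\<^sup>+a. U (f a) l \<partial>\<mu>)"

definition total_mass ::
    "('a \<Rightarrow> nat) \<Rightarrow> ('b \<Rightarrow> nat) \<Rightarrow> (nat \<Rightarrow> nat \<Rightarrow> ennreal) \<Rightarrow> 'a measure \<Rightarrow> 'b measure \<Rightarrow> ennreal" where
  "total_mass f g U \<mu> \<nu> = (\<integral>\<^sup>+a. row_mass g U \<nu> (f a) \<partial>\<mu>)"

text \<open>Both marginals of the encoded measure stay below \<mu> and \<nu>, so the truncated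
  subtractions in \<open>fill_density\<close> are genuine, and the strict bound on the mass keeps
  its denominator positive. Labels are natural numbers, so these are countably many conditions and
  hence measurable in parameters of \<mu> and \<nu>.\<close>

definition admissible ::
    "('a \<Rightarrow> nat) \<Rightarrow> ('b \<Rightarrow> nat) \<Rightarrow> (nat \<Rightarrow> nat \<Rightarrow> ennreal) \<Rightarrow> 'a measure \<Rightarrow> 'b measure \<Rightarrow> bool" where
  "admissible f g U \<mu> \<nu> \<longleftrightarrow>
     (\<forall>k. row_mass g U \<nu> k \<le> 1) \<and> (\<forall>l. col_mass f U \<mu> l \<le> 1) \<and> total_mass f g U \<mu> \<nu> < 1"

text \<open>The added term is the product of the two marginal defects, divided by their common total
  mass so that it supplies exactly what each marginal lacks.\<close>

definition fill_density ::
    "('a \<Rightarrow> nat) \<Rightarrow> ('b \<Rightarrow> nat) \<Rightarrow> (nat \<Rightarrow> nat \<Rightarrow> ennreal) \<Rightarrow> 'a measure \<Rightarrow> 'b measure \<Rightarrow> 'a \<times> 'b \<Rightarrow> ennreal" where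
  "fill_density f g U \<mu> \<nu> p =
     U (f (fst p)) (g (snd p))
     + (1 - row_mass g U \<nu> (f (fst p))) * (1 - col_mass f U \<mu> (g (snd p)))
         / (1 - total_mass f g U \<mu> \<nu>)"

text \<open>Without admissibility the density is 1, which gives the product measure. So every
  \<open>U\<close> yields a coupling, and a selection among candidates has to check only their
  cost.\<close>

definition step_coupling ::
    "('a \<Rightarrow> nat) \<Rightarrow> ('b \<Rightarrow> nat) \<Rightarrow> (nat \<Rightarrow> nat \<Rightarrow> ennreal) \<Rightarrow> 'a measure \<Rightarrow> 'b measure \<Rightarrow> ('a \<times> 'b) measure" where
  "step_coupling f g U \<mu> \<nu> =
     density (\<mu> \<Otimes>\<^sub>M \<nu>) (\<lambda>p. if admissible f g U \<mu> \<nu> then fill_density f g U \<mu> \<nu> p else 1)"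

text \<open>Since there are countably many labels, the integrand is a countable sum of multiples of
  cell indicators.\<close>

lemma nn_integral_label:
  fixes f :: "'a \<Rightarrow> nat" and G :: "nat \<Rightarrow> ennreal"
  assumes f[measurable]: "f \<in> M \<rightarrow>\<^sub>M count_space UNIV"
  shows "(\<integral>\<^sup>+x. G (f x) \<partial>M) = (\<Sum>k. G k * emeasure M {x \<in> space M. f x = k})"
proof -
  have "(\<integral>\<^sup>+x. G (f x) \<partial>M) = (\<integral>\<^sup>+x. (\<Sum>k. G k * indicator {x \<in> space M. f x = k} x) \<partial>M)"
  proof (rule nn_integral_cong)
    fix x assume "x \<in> space M"
    then have "(\<Sum>k. G k * indicator {x \<in> space M. f x = k} x) = (\<Sum>k. if k = f x then G k else 0)"
      by (intro suminf_cong) (auto simp: indicator_def)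
    also have "\<dots> = G (f x)"
      by (subst suminf_finite[of "{f x}"]) auto
    finally show "G (f x) = (\<Sum>k. G k * indicator {x \<in> space M. f x = k} x)" by simp
  qed
  also have "\<dots> = (\<Sum>k. G k * emeasure M {x \<in> space M. f x = k})"
    by (subst nn_integral_suminf) (auto simp: nn_integral_cmult)
  finally show ?thesis .
qed

locale labelled_pair = pair_prob_space M1 M2 for M1 :: "'a measure" and M2 :: "'b measure" +
  fixes f :: "'a \<Rightarrow> nat" and g :: "'b \<Rightarrow> nat"
  assumes f[measurable]: "f \<in> M1 \<rightarrow>\<^sub>M count_space UNIV"
    and g[measurable]: "g \<in> M2 \<rightarrow>\<^sub>M count_space UNIV"
begin

lemma label_compose1: "(\<lambda>a. h (f a)) \<in> M1 \<rightarrow>\<^sub>M borel"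
  by (rule measurable_compose[OF f]) simp

lemma label_compose2: "(\<lambda>b. h (g b)) \<in> M2 \<rightarrow>\<^sub>M borel"
  by (rule measurable_compose[OF g]) simp

lemma label_compose_pair:
  "(\<lambda>p. h (f (fst p)) (g (snd p))) \<in> M1 \<Otimes>\<^sub>M M2 \<rightarrow>\<^sub>M borel"
  by (rule measurable_compose_countable[OF measurable_compose_countable])
    (auto intro: measurable_compose[OF _ f] measurable_compose[OF _ g])

lemma label_measurable:
  fixes U :: "nat \<Rightarrow> nat \<Rightarrow> ennreal"
  shows "(\<lambda>a. row_mass g U M2 (f a)) \<in> borel_measurable M1"
    and "(\<lambda>b. col_mass f U M1 (g b)) \<in> borel_measurable M2"
    and "(\<lambda>p. row_mass g U M2 (f (fst p))) \<in> borel_measurable (M1 \<Otimes>\<^sub>M M2)"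
    and "(\<lambda>p. col_mass f U M1 (g (snd p))) \<in> borel_measurable (M1 \<Otimes>\<^sub>M M2)"
    and "(\<lambda>a. U (f a) l) \<in> borel_measurable M1" and "(\<lambda>b. U k (g b)) \<in> borel_measurable M2"
    and "(\<lambda>p. U (f (fst p)) (g (snd p))) \<in> borel_measurable (M1 \<Otimes>\<^sub>M M2)"
    and "(\<lambda>(a, b). U (f a) (g b)) \<in> borel_measurable (M1 \<Otimes>\<^sub>M M2)"
    and "(\<lambda>(b, a). U (f a) (g b)) \<in> borel_measurable (M2 \<Otimes>\<^sub>M M1)"
proof -
  show "(\<lambda>p. U (f (fst p)) (g (snd p))) \<in> borel_measurable (M1 \<Otimes>\<^sub>M M2)"
    by (rule label_compose_pair)
  then show "(\<lambda>(a, b). U (f a) (g b)) \<in> borel_measurable (M1 \<Otimes>\<^sub>M M2)"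
    by (simp add: case_prod_beta')
  then show "(\<lambda>(b, a). U (f a) (g b)) \<in> borel_measurable (M2 \<Otimes>\<^sub>M M1)"
    by (subst measurable_pair_swap_iff) (simp add: case_prod_beta')
qed (auto intro: label_compose1 label_compose2 label_compose1[THEN measurable_compose[OF measurable_fst]]
       label_compose2[THEN measurable_compose[OF measurable_snd]])

lemma fill_density_measurable[measurable]: "fill_density f g U M1 M2 \<in> borel_measurable (M1 \<Otimes>\<^sub>M M2)"
proof -
  note [measurable] = label_measurable[of U]
  show ?thesis unfolding fill_density_def[abs_def] by measurable
qed

lemma nn_integral_times_pair:
  assumes [measurable]: "u \<in> borel_measurable M1" "v \<in> borel_measurable M2"
  shows "(\<integral>\<^sup>+p. u (fst p) * v (snd p) \<partial>(M1 \<Otimes>\<^sub>M M2)) = (\<integral>\<^sup>+a. u a \<partial>M1) * (\<integral>\<^sup>+b. v b \<partial>M2)"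
  by (subst M2.nn_integral_fst[symmetric]) (simp_all add: nn_integral_cmult nn_integral_multc)

text \<open>By Tonelli the mass can be computed from either side, so the row defect and the column
  defect have the same total.\<close>

lemma total_mass_eq_col: "total_mass f g U M1 M2 = (\<integral>\<^sup>+b. col_mass f U M1 (g b) \<partial>M2)"
  unfolding total_mass_def row_mass_def col_mass_def
  by (rule Fubini'[symmetric]) (rule label_measurable)

context
  fixes U assumes adm: "admissible f g U M1 M2"
begin

lemma row_le: "row_mass g U M2 k \<le> 1" and col_le: "col_mass f U M1 l \<le> 1"
  and total_less: "total_mass f g U M1 M2 < 1"
  using adm by (auto simp: admissible_def)

lemma integral_row_defect: "(\<integral>\<^sup>+a. 1 - row_mass g U M2 (f a) \<partial>M1) = 1 - total_mass f g U M1 M2"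
  using row_le total_less label_measurable[of U] unfolding total_mass_def
  by (subst nn_integral_diff) (auto simp: M1.emeasure_space_1 less_top[symmetric] dest: order_less_trans)

lemma integral_col_defect: "(\<integral>\<^sup>+b. 1 - col_mass f U M1 (g b) \<partial>M2) = 1 - total_mass f g U M1 M2"
  using col_le total_less label_measurable[of U] unfolding total_mass_eq_col
  by (subst nn_integral_diff) (auto simp: M2.emeasure_space_1 less_top[symmetric] dest: order_less_trans)

lemma defect_ratio: "(1 - total_mass f g U M1 M2) / (1 - total_mass f g U M1 M2) = 1"
  using total_less
  by (intro ennreal_divide_self)
    (auto simp: diff_eq_0_iff_ennreal not_le intro: le_less_trans[OF diff_le_self_ennreal])

text \<open>Integrating out \<open>b\<close> turns the column defect into the total defect, which
  cancels the denominator and leaves the row mass plus the row defect.\<close>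

lemma integral_fill_row: "(\<integral>\<^sup>+b. fill_density f g U M1 M2 (a, b) \<partial>M2) = 1"
proof -
  note [measurable] = label_measurable[of U]
  have "(\<integral>\<^sup>+b. fill_density f g U M1 M2 (a, b) \<partial>M2)
     = row_mass g U M2 (f a) + (1 - row_mass g U M2 (f a)) *
        ((1 - total_mass f g U M1 M2) / (1 - total_mass f g U M1 M2))"
    unfolding fill_density_def
    by (simp add: nn_integral_add nn_integral_cmult nn_integral_divide integral_col_defect
          ennreal_times_divide row_mass_def)
  then show ?thesis
    using row_le[of "f a"] by (simp add: defect_ratio)
qed

lemma integral_fill_col: "(\<integral>\<^sup>+a. fill_density f g U M1 M2 (a, b) \<partial>M1) = 1"
proof -
  note [measurable] = label_measurable[of U]
  have "(\<integral>\<^sup>+a. fill_density f g U M1 M2 (a, b) \<partial>M1)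
     = col_mass f U M1 (g b) + (1 - col_mass f U M1 (g b)) *
        ((1 - total_mass f g U M1 M2) / (1 - total_mass f g U M1 M2))"
    unfolding fill_density_def
    by (simp add: nn_integral_add nn_integral_multc nn_integral_divide integral_row_defect
          ennreal_times_divide col_mass_def mult.commute)
  then show ?thesis
    using col_le[of "g b"] by (simp add: defect_ratio)
qed

text \<open>On the filled-up part, a product measure, the bound \<phi> + \<psi> for the cost splits
  the integral into two products. In each of them the factor without \<phi> or \<psi> is the total
  defect and cancels the denominator.\<close>

lemma nn_integral_fill_le:
  assumes [measurable]: "d \<in> borel_measurable (M1 \<Otimes>\<^sub>M M2)" "\<phi> \<in> borel_measurable M1" "\<psi> \<in> borel_measurable M2"
    and d: "\<And>a b. a \<in> space M1 \<Longrightarrow> b \<in> space M2 \<Longrightarrow> d (a, b) \<le> \<phi> a + \<psi> b"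
  shows "(\<integral>\<^sup>+p. fill_density f g U M1 M2 p * d p \<partial>(M1 \<Otimes>\<^sub>M M2))
     \<le> (\<integral>\<^sup>+p. U (f (fst p)) (g (snd p)) * d p \<partial>(M1 \<Otimes>\<^sub>M M2))
       + (\<integral>\<^sup>+a. (1 - row_mass g U M2 (f a)) * \<phi> a \<partial>M1) + (\<integral>\<^sup>+b. (1 - col_mass f U M1 (g b)) * \<psi> b \<partial>M2)"
proof -
  note [measurable] = label_measurable[of U]
  let ?t = "1 - total_mass f g U M1 M2"
  let ?r = "\<lambda>a. 1 - row_mass g U M2 (f a)" and ?s = "\<lambda>b. 1 - col_mass f U M1 (g b)"
  have split: "(\<integral>\<^sup>+p. fill_density f g U M1 M2 p * d p \<partial>(M1 \<Otimes>\<^sub>M M2))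
     = (\<integral>\<^sup>+p. U (f (fst p)) (g (snd p)) * d p \<partial>(M1 \<Otimes>\<^sub>M M2))
       + (\<integral>\<^sup>+p. ?r (fst p) * ?s (snd p) / ?t * d p \<partial>(M1 \<Otimes>\<^sub>M M2))"
    unfolding fill_density_def distrib_right
    by (rule nn_integral_add) (intro borel_measurable_times_ennreal borel_measurable_divide_ennreal
      borel_measurable_minus_ennreal borel_measurable_const assms label_measurable)+
  have "(\<integral>\<^sup>+p. ?r (fst p) * ?s (snd p) / ?t * d p \<partial>(M1 \<Otimes>\<^sub>M M2))
    \<le> (\<integral>\<^sup>+p. (?r (fst p) * \<phi> (fst p) * ?s (snd p) + ?r (fst p) * (?s (snd p) * \<psi> (snd p))) / ?t \<partial>(M1 \<Otimes>\<^sub>M M2))"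
  proof (rule nn_integral_mono)
    fix p assume "p \<in> space (M1 \<Otimes>\<^sub>M M2)"
    then have "d p \<le> \<phi> (fst p) + \<psi> (snd p)"
      using d[of "fst p" "snd p"] by (auto simp: space_pair_measure)
    then have "x * y / z * d p \<le> x * y / z * (\<phi> (fst p) + \<psi> (snd p))" for x y z :: ennreal
      by (rule mult_left_mono) simp
    moreover have "x * y / z * (v + w) = (x * v * y + x * (y * w)) / z" for x y z v w :: ennreal
      by (simp add: divide_ennreal_def algebra_simps)
    ultimately show "?r (fst p) * ?s (snd p) / ?t * d p
        \<le> (?r (fst p) * \<phi> (fst p) * ?s (snd p) + ?r (fst p) * (?s (snd p) * \<psi> (snd p))) / ?t"
      by metis
  qed
  also have "\<dots> = ((\<integral>\<^sup>+a. ?r a * \<phi> a \<partial>M1) * (\<integral>\<^sup>+b. ?s b \<partial>M2) + (\<integral>\<^sup>+a. ?r a \<partial>M1) * (\<integral>\<^sup>+b. ?s b * \<psi> b \<partial>M2)) / ?t"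
  proof -
    have r: "?r \<in> borel_measurable M1" and s: "?s \<in> borel_measurable M2"
      by (intro borel_measurable_minus_ennreal borel_measurable_const label_measurable)+
    have "(\<integral>\<^sup>+p. (u (fst p) * v (snd p) + u' (fst p) * v' (snd p)) / ?t \<partial>(M1 \<Otimes>\<^sub>M M2))
      = ((\<integral>\<^sup>+a. u a \<partial>M1) * (\<integral>\<^sup>+b. v b \<partial>M2) + (\<integral>\<^sup>+a. u' a \<partial>M1) * (\<integral>\<^sup>+b. v' b \<partial>M2)) / ?t"
      if [measurable]: "u \<in> borel_measurable M1" "v \<in> borel_measurable M2"
        "u' \<in> borel_measurable M1" "v' \<in> borel_measurable M2" for u v u' v'
      by (simp add: nn_integral_divide nn_integral_add nn_integral_times_pair)
    from this[OF _ s r, of "\<lambda>a. ?r a * \<phi> a" "\<lambda>b. ?s b * \<psi> b"] show ?thesis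
      using r s by simp
  qed
  also have "\<dots> = ((\<integral>\<^sup>+a. ?r a * \<phi> a \<partial>M1) + (\<integral>\<^sup>+b. ?s b * \<psi> b \<partial>M2)) * (?t / ?t)"
    unfolding integral_row_defect integral_col_defect by (simp add: divide_ennreal_def algebra_simps)
  also have "\<dots> = (\<integral>\<^sup>+a. ?r a * \<phi> a \<partial>M1) + (\<integral>\<^sup>+b. ?s b * \<psi> b \<partial>M2)"
    by (simp add: defect_ratio)
  finally show ?thesis unfolding split by (simp add: add.assoc add_left_mono)
qed

end

text \<open>In both branches the density integrates to 1 over each variable separately, and by
  Tonelli this gives the two marginals.\<close>

lemma step_coupling_couplings: "step_coupling f g U M1 M2 \<in> couplings M1 M2"
proof -
  define w where "w = (\<lambda>p. if admissible f g U M1 M2 then fill_density f g U M1 M2 p else 1)"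
  have [measurable]: "w \<in> borel_measurable (M1 \<Otimes>\<^sub>M M2)"
    unfolding w_def by (cases "admissible f g U M1 M2") simp_all
  have row: "(\<integral>\<^sup>+b. w (a, b) \<partial>M2) = 1" for a
    by (cases "admissible f g U M1 M2") (simp_all add: w_def integral_fill_row M2.emeasure_space_1)
  have col: "(\<integral>\<^sup>+a. w (a, b) \<partial>M1) = 1" for b
    by (cases "admissible f g U M1 M2") (simp_all add: w_def integral_fill_col M1.emeasure_space_1)
  let ?Q = "density (M1 \<Otimes>\<^sub>M M2) w"
  have "distr ?Q M1 fst = M1"
  proof (rule measure_eqI)
    fix X assume "X \<in> sets (distr ?Q M1 fst)"
    then have [measurable]: "X \<in> sets M1" by simp
    have "emeasure (distr ?Q M1 fst) X = (\<integral>\<^sup>+p. indicator X (fst p) \<partial>?Q)"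
      by (simp add: nn_integral_distr flip: nn_integral_indicator)
    also have "\<dots> = (\<integral>\<^sup>+p. w p * indicator X (fst p) \<partial>(M1 \<Otimes>\<^sub>M M2))"
      by (rule nn_integral_density) measurable
    also have "\<dots> = (\<integral>\<^sup>+a. indicator X a \<partial>M1)"
      by (subst M2.nn_integral_fst[symmetric])
        (measurable, intro nn_integral_cong, simp add: nn_integral_multc row)
    finally show "emeasure (distr ?Q M1 fst) X = emeasure M1 X" by simp
  qed simp
  moreover have "distr ?Q M2 snd = M2"
  proof (rule measure_eqI)
    fix X assume "X \<in> sets (distr ?Q M2 snd)"
    then have [measurable]: "X \<in> sets M2" by simp
    have "emeasure (distr ?Q M2 snd) X = (\<integral>\<^sup>+p. indicator X (snd p) \<partial>?Q)"
      by (simp add: nn_integral_distr flip: nn_integral_indicator)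
    also have "\<dots> = (\<integral>\<^sup>+p. w p * indicator X (snd p) \<partial>(M1 \<Otimes>\<^sub>M M2))"
      by (rule nn_integral_density) measurable
    also have "\<dots> = (\<integral>\<^sup>+b. indicator X b \<partial>M2)"
      by (subst nn_integral_snd[symmetric])
        (measurable, intro nn_integral_cong, simp add: nn_integral_multc col)
    finally show "emeasure (distr ?Q M2 snd) X = emeasure M2 X" by simp
  qed simp
  ultimately show ?thesis
    by (simp add: couplings_def step_coupling_def w_def)
qed

end

subsection \<open>Cell averages of a coupling\<close>

text \<open>The density of the coupling obtained from \<gamma> by spreading its mass on each product
  of cells proportionally to the product measure. If the denominator vanishes so does the numerator,
  and the quotient is then 0.\<close>

definition cell_density ::
    "('a \<Rightarrow> nat) \<Rightarrow> ('b \<Rightarrow> nat) \<Rightarrow> ('a \<times> 'b) measure \<Rightarrow> 'a measure \<Rightarrow> 'b measure \<Rightarrow> nat \<Rightarrow> nat \<Rightarrow> ennreal" where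
  "cell_density f g \<gamma> \<mu> \<nu> k l =
     emeasure \<gamma> {p \<in> space \<gamma>. f (fst p) = k \<and> g (snd p) = l}
       / (emeasure \<mu> {a \<in> space \<mu>. f a = k} * emeasure \<nu> {b \<in> space \<nu>. g b = l})"

text \<open>One list of natural numbers encodes a whole matrix: its length fixes both the precision
  and the number of entries that may be nonzero. Lists of naturals form a countable type, which
  makes the set of candidates countable.\<close>

definition dyadic :: "nat list \<Rightarrow> nat \<Rightarrow> nat \<Rightarrow> ennreal" where
  "dyadic L k l = (if prod_encode (k, l) < length L
     then ennreal (real (L ! prod_encode (k, l)) / 2 ^ length L) else 0)"

lemma dyadic_approximation:
  assumes fin: "\<And>k l. c k l < \<top>"
  obtains L :: "nat \<Rightarrow> nat list" where "\<And>n k l. dyadic (L n) k l \<le> ennreal (real n / real (n + 1)) * c k l"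
    and "\<And>k l. (\<lambda>n. dyadic (L n) k l) \<longlonglongrightarrow> c k l"
proof -
  define x where "x i = enn2real (case_prod c (prod_decode i))" for i
  have x0: "0 \<le> x i" for i by (simp add: x_def)
  have cx: "c k l = ennreal (x (prod_encode (k, l)))" for k l
    using fin[of k l] by (simp add: x_def less_top)
  \<comment> \<open>Scaling by \<open>n / (n + 1)\<close> before rounding keeps the total mass
    strictly below 1 and disappears in the limit.\<close>
  define y where "y n i = real n / real (n + 1) * x i" for n i
  \<comment> \<open>The list has length \<open>n\<close>, so precision and support grow together:
    entry \<open>i\<close> is rounded down to a multiple of \<open>1 / 2 ^ n\<close> as soon as
    \<open>i < n\<close>.\<close>
  define L where "L n = map (\<lambda>i. nat \<lfloor>2 ^ n * y n i\<rfloor>) [0..<n]" for n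
  have y0: "0 \<le> y n i" for n i using x0 by (simp add: y_def)
  have L: "dyadic (L n) k l = (let i = prod_encode (k, l) in
      if i < n then ennreal (real_of_int \<lfloor>2 ^ n * y n i\<rfloor> / 2 ^ n) else 0)" for n k l
    using y0 by (simp add: dyadic_def L_def Let_def)
  show thesis
  proof
    fix n k l
    let ?i = "prod_encode (k, l)"
    have "real_of_int \<lfloor>2 ^ n * y n ?i\<rfloor> / 2 ^ n \<le> y n ?i"
      by (simp add: divide_le_eq mult.commute)
    then have "dyadic (L n) k l \<le> ennreal (y n ?i)"
      unfolding L by (auto simp: Let_def intro!: ennreal_leI)
    also have "\<dots> = ennreal (real n / real (n + 1)) * c k l"
      by (simp add: cx y_def x0 flip: ennreal_mult)
    finally show "dyadic (L n) k l \<le> ennreal (real n / real (n + 1)) * c k l" .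
  next
    fix k l
    let ?i = "prod_encode (k, l)"
    have "(\<lambda>n. real n / real (n + 1)) \<longlonglongrightarrow> 1"
      using LIMSEQ_n_over_Suc_n[where 'a=real] by simp
    from tendsto_mult_right[OF this, of "x ?i"] have y: "(\<lambda>n. y n ?i) \<longlonglongrightarrow> x ?i"
      unfolding y_def by simp
    have p: "(\<lambda>n. (1 / 2) ^ n) \<longlonglongrightarrow> (0 :: real)"
      by (intro LIMSEQ_realpow_zero) auto
    have "(\<lambda>n. real_of_int \<lfloor>2 ^ n * y n ?i\<rfloor> / 2 ^ n) \<longlonglongrightarrow> x ?i"
    proof (rule tendsto_sandwich)
      show "(\<lambda>n. y n ?i - (1 / 2) ^ n) \<longlonglongrightarrow> x ?i"
        using tendsto_diff[OF y p] by simp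
      show "\<forall>\<^sub>F n in sequentially. y n ?i - (1 / 2) ^ n \<le> real_of_int \<lfloor>2 ^ n * y n ?i\<rfloor> / 2 ^ n"
      proof (rule always_eventually, rule allI)
        fix n
        have "2 ^ n * y n ?i - 1 \<le> real_of_int \<lfloor>2 ^ n * y n ?i\<rfloor>" by linarith
        then have "(2 ^ n * y n ?i - 1) / 2 ^ n \<le> real_of_int \<lfloor>2 ^ n * y n ?i\<rfloor> / 2 ^ n"
          by (rule divide_right_mono) simp
        then show "y n ?i - (1 / 2) ^ n \<le> real_of_int \<lfloor>2 ^ n * y n ?i\<rfloor> / 2 ^ n"
          by (simp add: diff_divide_distrib power_one_over)
      qed
      show "\<forall>\<^sub>F n in sequentially. real_of_int \<lfloor>2 ^ n * y n ?i\<rfloor> / 2 ^ n \<le> y n ?i"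
        by (simp add: divide_le_eq mult.commute)
    qed (fact y)
    then have "(\<lambda>n. ennreal (real_of_int \<lfloor>2 ^ n * y n ?i\<rfloor> / 2 ^ n)) \<longlonglongrightarrow> c k l"
      unfolding cx by (rule tendsto_ennrealI)
    moreover have "\<forall>\<^sub>F n in sequentially. ennreal (real_of_int \<lfloor>2 ^ n * y n ?i\<rfloor> / 2 ^ n) = dyadic (L n) k l"
      using eventually_gt_at_top[of ?i] by eventually_elim (simp add: L Let_def)
    ultimately show "(\<lambda>n. dyadic (L n) k l) \<longlonglongrightarrow> c k l"
      by (rule Lim_transform_eventually)
  qed
qed

section \<open>Integrals against the marginals of a coupling\<close>

lemma couplings_prob_space:
  assumes "\<gamma> \<in> couplings \<mu> \<nu>" "prob_space \<mu>"
  shows "prob_space \<gamma>"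
proof (rule prob_space_distrD)
  show "fst \<in> \<gamma> \<rightarrow>\<^sub>M \<mu>"
    using assms(1) by (simp add: couplings_def cong: measurable_cong_sets)
  show "prob_space (distr \<gamma> \<mu> fst)"
    using assms by (simp add: couplings_def)
qed

lemma nn_integral_coupling_fst:
  assumes \<gamma>: "\<gamma> \<in> couplings \<mu> \<nu>" and h: "h \<in> borel_measurable \<mu>"
  shows "(\<integral>\<^sup>+p. h (fst p) \<partial>\<gamma>) = (\<integral>\<^sup>+a. h a \<partial>\<mu>)"
proof -
  have "sets \<gamma> = sets (\<mu> \<Otimes>\<^sub>M \<nu>)" and d: "distr \<gamma> \<mu> fst = \<mu>"
    using \<gamma> by (auto simp: couplings_def)
  then have "fst \<in> \<gamma> \<rightarrow>\<^sub>M \<mu>" by (simp cong: measurable_cong_sets)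
  then show ?thesis using nn_integral_distr[of fst \<gamma> \<mu> h] h d by simp
qed

lemma nn_integral_coupling_snd:
  assumes \<gamma>: "\<gamma> \<in> couplings \<mu> \<nu>" and h: "h \<in> borel_measurable \<nu>"
  shows "(\<integral>\<^sup>+p. h (snd p) \<partial>\<gamma>) = (\<integral>\<^sup>+b. h b \<partial>\<nu>)"
proof -
  have "sets \<gamma> = sets (\<mu> \<Otimes>\<^sub>M \<nu>)" and d: "distr \<gamma> \<nu> snd = \<nu>"
    using \<gamma> by (auto simp: couplings_def)
  then have "snd \<in> \<gamma> \<rightarrow>\<^sub>M \<nu>" by (simp cong: measurable_cong_sets)
  then show ?thesis using nn_integral_distr[of snd \<gamma> \<nu> h] h d by simp
qed

context labelled_pair
begin

abbreviation "A k \<equiv> {a \<in> space M1. f a = k}"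
abbreviation "B l \<equiv> {b \<in> space M2. g b = l}"

context
  fixes \<gamma> assumes \<gamma>: "\<gamma> \<in> couplings M1 M2"
begin

abbreviation "cell \<equiv> cell_density f g \<gamma> M1 M2"

lemma sets_gamma[measurable_cong]: "sets \<gamma> = sets (M1 \<Otimes>\<^sub>M M2)"
  using \<gamma> by (simp add: couplings_def)

lemma space_gamma: "space \<gamma> = space M1 \<times> space M2"
  using sets_eq_imp_space_eq[OF sets_gamma] by (simp add: space_pair_measure)

text \<open>The mass that \<gamma> gives to a product of cells is at most the mass of either factor
  under its marginal. So it vanishes with the denominator, and multiplying back is valid also for
  null cells.\<close>

lemma cell_density_times:
  "cell k l * (emeasure M1 (A k) * emeasure M2 (B l))
     = emeasure \<gamma> {p \<in> space \<gamma>. f (fst p) = k \<and> g (snd p) = l}" (is "_ = emeasure \<gamma> ?C")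
  and cell_density_finite: "cell k l < \<top>"
proof -
  have d: "distr \<gamma> M1 fst = M1" "distr \<gamma> M2 snd = M2"
    using \<gamma> by (auto simp: couplings_def)
  have [measurable]: "fst \<in> \<gamma> \<rightarrow>\<^sub>M M1" "snd \<in> \<gamma> \<rightarrow>\<^sub>M M2"
    by measurable
  have "emeasure \<gamma> ?C \<le> emeasure \<gamma> (fst -` A k \<inter> space \<gamma>)"
    by (rule emeasure_mono) (auto simp: space_gamma)
  also have "\<dots> = emeasure (distr \<gamma> M1 fst) (A k)"
    by (rule emeasure_distr[symmetric]) measurable
  finally have C1: "emeasure \<gamma> ?C \<le> emeasure M1 (A k)" by (simp add: d)
  have "emeasure \<gamma> ?C \<le> emeasure \<gamma> (snd -` B l \<inter> space \<gamma>)"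
    by (rule emeasure_mono) (auto simp: space_gamma)
  also have "\<dots> = emeasure (distr \<gamma> M2 snd) (B l)"
    by (rule emeasure_distr[symmetric]) measurable
  finally have C2: "emeasure \<gamma> ?C \<le> emeasure M2 (B l)" by (simp add: d)
  have fin: "emeasure M1 (A k) * emeasure M2 (B l) \<noteq> \<top>" "emeasure \<gamma> ?C \<noteq> \<top>"
    using C1 by (auto simp: ennreal_mult_eq_top_iff top_unique)
  have "emeasure M1 (A k) * emeasure M2 (B l) = 0 \<Longrightarrow> emeasure \<gamma> ?C = 0"
    using C1 C2 by auto
  then show "cell k l * (emeasure M1 (A k) * emeasure M2 (B l)) = emeasure \<gamma> ?C" "cell k l < \<top>"
    using fin unfolding cell_density_def
    by (cases "emeasure M1 (A k) * emeasure M2 (B l) = 0";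
        simp add: ennreal_divide_times mult_divide_eq_ennreal ennreal_divide_eq_top_iff less_top[symmetric])+
qed

text \<open>The averaged coupling and \<gamma> give the same mass to every product of cells, so they
  agree on functions that are constant on such products.\<close>

lemma nn_integral_cell_density:
  "(\<integral>\<^sup>+p. cell (f (fst p)) (g (snd p)) * h (f (fst p)) (g (snd p)) \<partial>(M1 \<Otimes>\<^sub>M M2))
     = (\<integral>\<^sup>+p. h (f (fst p)) (g (snd p)) \<partial>\<gamma>)"
proof -
  \<comment> \<open>Encoding the pair of labels as one number makes \<open>nn_integral_label\<close>
    applicable to both measures on the product space.\<close>
  define lab where "lab p = prod_encode (f (fst p), g (snd p))" for p
  have lab: "lab \<in> (M1 \<Otimes>\<^sub>M M2) \<rightarrow>\<^sub>M count_space UNIV"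
    unfolding lab_def by measurable
  then have lab': "lab \<in> \<gamma> \<rightarrow>\<^sub>M count_space UNIV"
    by (simp cong: measurable_cong_sets add: sets_gamma)
  let ?h = "\<lambda>i. case_prod h (prod_decode i)" and ?c = "\<lambda>i. case_prod cell (prod_decode i)"
  have "?c i * ?h i * emeasure (M1 \<Otimes>\<^sub>M M2) {p \<in> space (M1 \<Otimes>\<^sub>M M2). lab p = i}
      = ?h i * emeasure \<gamma> {p \<in> space \<gamma>. lab p = i}" for i
  proof -
    obtain k l where i: "i = prod_encode (k, l)" by (metis prod_decode_inverse surj_pair)
    have "{p \<in> space (M1 \<Otimes>\<^sub>M M2). lab p = i} = A k \<times> B l"
      by (auto simp: i lab_def space_pair_measure)
    then have "emeasure (M1 \<Otimes>\<^sub>M M2) {p \<in> space (M1 \<Otimes>\<^sub>M M2). lab p = i} = emeasure M1 (A k) * emeasure M2 (B l)"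
      by (simp add: M2.emeasure_pair_measure_Times)
    moreover have "{p \<in> space \<gamma>. lab p = i} = {p \<in> space \<gamma>. f (fst p) = k \<and> g (snd p) = l}"
      by (auto simp: i lab_def)
    ultimately show ?thesis
      using cell_density_times[of k l] by (simp add: i ac_simps)
  qed
  then have "(\<Sum>i. ?c i * ?h i * emeasure (M1 \<Otimes>\<^sub>M M2) {p \<in> space (M1 \<Otimes>\<^sub>M M2). lab p = i})
      = (\<Sum>i. ?h i * emeasure \<gamma> {p \<in> space \<gamma>. lab p = i})"
    by simp
  then show ?thesis
    by (simp add: nn_integral_label[OF lab, symmetric, of "\<lambda>i. ?c i * ?h i"]
        nn_integral_label[OF lab', symmetric, of ?h]) (simp add: lab_def)
qed

text \<open>Averaging preserves the marginals: multiplied by the mass of the cell, the row mass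
  becomes the mass that \<gamma> gives to the strip over that cell, which is again the mass of the
  cell. On null cells all densities are 0 by the convention for the quotient.\<close>

lemma row_cell_density: "row_mass g cell M2 k = (if emeasure M1 (A k) = 0 then 0 else 1)"
proof (cases "emeasure M1 (A k) = 0")
  case True
  then have "cell k l = 0" for l
    using cell_density_times[of k l] by (simp add: cell_density_def)
  then show ?thesis using True by (simp add: row_mass_def)
next
  case False
  have "emeasure M1 (A k) * row_mass g cell M2 k
     = (\<integral>\<^sup>+p. indicator (A k) (fst p) * cell k (g (snd p)) \<partial>(M1 \<Otimes>\<^sub>M M2))"
    by (subst nn_integral_times_pair) (auto simp: row_mass_def intro: label_measurable)
  also have "\<dots> = (\<integral>\<^sup>+p. cell (f (fst p)) (g (snd p)) * of_bool (f (fst p) = k) \<partial>(M1 \<Otimes>\<^sub>M M2))"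
    by (intro nn_integral_cong) (auto simp: space_pair_measure indicator_def)
  also have "\<dots> = (\<integral>\<^sup>+p. of_bool (f (fst p) = k) \<partial>\<gamma>)"
    by (rule nn_integral_cell_density)
  also have "\<dots> = (\<integral>\<^sup>+a. of_bool (f a = k) \<partial>M1)"
    by (rule nn_integral_coupling_fst[OF \<gamma>]) (rule label_compose1)
  also have "\<dots> = (\<integral>\<^sup>+a. indicator (A k) a \<partial>M1)"
    by (intro nn_integral_cong) (auto simp: indicator_def)
  also have "\<dots> = emeasure M1 (A k) * 1"
    by simp
  finally show ?thesis
    using False by (subst (asm) ennreal_mult_cancel_left) auto
qed

lemma col_cell_density: "col_mass f cell M1 l = (if emeasure M2 (B l) = 0 then 0 else 1)"
proof (cases "emeasure M2 (B l) = 0")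
  case True
  then have "cell k l = 0" for k
    using cell_density_times[of k l] by (simp add: cell_density_def)
  then show ?thesis using True by (simp add: col_mass_def)
next
  case False
  have "emeasure M2 (B l) * col_mass f cell M1 l
     = (\<integral>\<^sup>+p. cell (f (fst p)) l * indicator (B l) (snd p) \<partial>(M1 \<Otimes>\<^sub>M M2))"
    by (subst nn_integral_times_pair) (auto simp: col_mass_def mult.commute intro: label_measurable)
  also have "\<dots> = (\<integral>\<^sup>+p. cell (f (fst p)) (g (snd p)) * of_bool (g (snd p) = l) \<partial>(M1 \<Otimes>\<^sub>M M2))"
    by (intro nn_integral_cong) (auto simp: space_pair_measure indicator_def)
  also have "\<dots> = (\<integral>\<^sup>+p. of_bool (g (snd p) = l) \<partial>\<gamma>)"
    by (rule nn_integral_cell_density)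
  also have "\<dots> = (\<integral>\<^sup>+b. of_bool (g b = l) \<partial>M2)"
    by (rule nn_integral_coupling_snd[OF \<gamma>]) (rule label_compose2)
  also have "\<dots> = (\<integral>\<^sup>+b. indicator (B l) b \<partial>M2)"
    by (intro nn_integral_cong) (auto simp: indicator_def)
  also have "\<dots> = emeasure M2 (B l) * 1"
    by simp
  finally show ?thesis
    using False by (subst (asm) ennreal_mult_cancel_left) auto
qed

end

end

text \<open>The null cells are countably many, so their union is null. This is what makes the row
  and column masses of the averaged coupling equal to 1 almost everywhere.\<close>

lemma AE_label_positive:
  fixes f :: "'a \<Rightarrow> nat"
  assumes [measurable]: "f \<in> M \<rightarrow>\<^sub>M count_space UNIV"
  shows "AE x in M. emeasure M {y \<in> space M. f y = f x} \<noteq> 0"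
proof -
  have "AE x in M. f x = k \<longrightarrow> emeasure M {y \<in> space M. f y = k} \<noteq> 0" for k
  proof (cases "emeasure M {y \<in> space M. f y = k} = 0")
    case True
    then show ?thesis
      by (intro AE_I[where N="{y \<in> space M. f y = k}"]) auto
  qed simp
  then have "AE x in M. \<forall>k. f x = k \<longrightarrow> emeasure M {y \<in> space M. f y = k} \<noteq> 0"
    by (subst AE_all_countable) blast
  then show ?thesis by eventually_elim simp
qed

section \<open>Rounding an averaged coupling to an admissible dyadic density\<close>

context labelled_pair
begin

text \<open>Rounding down does not increase the cost of the density itself. The cost of the
  filled-up mass is controlled by the row and column defects weighted with \<phi> and \<psi>; these
  defects tend to 0 almost everywhere, and integrability of \<phi> and \<psi> lets dominated
  convergence make the cost smaller than any \<open>e > 0\<close>.\<close>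

lemma ex_dyadic_fill:
  assumes \<gamma>: "\<gamma> \<in> couplings M1 M2"
    and [measurable]: "d \<in> borel_measurable (M1 \<Otimes>\<^sub>M M2)" "\<phi> \<in> borel_measurable M1" "\<psi> \<in> borel_measurable M2"
    and d: "\<And>a b. a \<in> space M1 \<Longrightarrow> b \<in> space M2 \<Longrightarrow> d (a, b) \<le> \<phi> a + \<psi> b"
    and \<phi>: "(\<integral>\<^sup>+a. \<phi> a \<partial>M1) < \<top>" and \<psi>: "(\<integral>\<^sup>+b. \<psi> b \<partial>M2) < \<top>" and e: "0 < (e::real)"
  obtains L where "admissible f g (dyadic L) M1 M2"
    and "(\<integral>\<^sup>+p. fill_density f g (dyadic L) M1 M2 p * d p \<partial>(M1 \<Otimes>\<^sub>M M2))
      \<le> (\<integral>\<^sup>+p. cell_density f g \<gamma> M1 M2 (f (fst p)) (g (snd p)) * d p \<partial>(M1 \<Otimes>\<^sub>M M2)) + ennreal e"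
proof -
  let ?c = "cell_density f g \<gamma> M1 M2"
  define r where "r n = ennreal (real n / real (n + 1))" for n
  have r1: "r n < 1" for n by (simp add: r_def ennreal_less_one_iff)
  obtain L :: "nat \<Rightarrow> nat list" where le: "\<And>n k l. dyadic (L n) k l \<le> r n * ?c k l"
    and lim: "\<And>k l. (\<lambda>n. dyadic (L n) k l) \<longlonglongrightarrow> ?c k l"
    using dyadic_approximation[of ?c] cell_density_finite[OF \<gamma>] unfolding r_def by blast
  have le': "dyadic (L n) k l \<le> ?c k l" for n k l
  proof -
    have "dyadic (L n) k l \<le> r n * ?c k l" by (rule le)
    also have "\<dots> \<le> 1 * ?c k l" by (intro mult_right_mono) (auto intro: less_imp_le r1)
    finally show ?thesis by simp
  qed
  have row: "row_mass g ?c M2 k \<le> 1" and col: "col_mass f ?c M1 l \<le> 1" for k l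
    using row_cell_density[OF \<gamma>] col_cell_density[OF \<gamma>] by auto
  have rowL: "row_mass g (dyadic (L n)) M2 k \<le> r n * row_mass g ?c M2 k" for n k
    unfolding row_mass_def
    by (subst nn_integral_cmult[symmetric]) (intro nn_integral_mono le label_measurable)+
  have rowL1: "row_mass g (dyadic (L n)) M2 k \<le> r n" for n k
    using rowL[of n k] mult_left_mono[OF row[of k], of "r n"] by auto
  have colL1: "col_mass f (dyadic (L n)) M1 l \<le> 1" for n l
    unfolding col_mass_def
    by (rule order_trans[OF nn_integral_mono col[of l, unfolded col_mass_def]]) (rule le')
  have adm: "admissible f g (dyadic (L n)) M1 M2" for n
  proof -
    \<comment> \<open>Here the scaling factor pays off: every row mass is at most
      \<open>r n < 1\<close>, hence so is the total.\<close>
    have "total_mass f g (dyadic (L n)) M1 M2 \<le> (\<integral>\<^sup>+a. r n \<partial>M1)"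
      unfolding total_mass_def by (intro nn_integral_mono rowL1)
    also have "\<dots> < 1"
      by (simp add: M1.emeasure_space_1 r1)
    finally have "total_mass f g (dyadic (L n)) M1 M2 < 1" .
    then show ?thesis
      using order_trans[OF rowL1 less_imp_le[OF r1]] colL1 by (auto simp: admissible_def)
  qed
  have rlim: "(\<lambda>n. row_mass g (dyadic (L n)) M2 k) \<longlonglongrightarrow> row_mass g ?c M2 k" for k
    unfolding row_mass_def
  proof (rule nn_integral_dominated_convergence[where w="\<lambda>b. ?c k (g b)"])
    show "(\<integral>\<^sup>+b. ?c k (g b) \<partial>M2) < \<infinity>"
      using row[of k] unfolding row_mass_def by (auto intro: le_less_trans)
  qed (auto intro: label_measurable le' lim)
  have clim: "(\<lambda>n. col_mass f (dyadic (L n)) M1 l) \<longlonglongrightarrow> col_mass f ?c M1 l" for l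
    unfolding col_mass_def
  proof (rule nn_integral_dominated_convergence[where w="\<lambda>a. ?c (f a) l"])
    show "(\<integral>\<^sup>+a. ?c (f a) l \<partial>M1) < \<infinity>"
      using col[of l] unfolding col_mass_def by (auto intro: le_less_trans)
  qed (auto intro: label_measurable le' lim)
  have "(\<lambda>n. \<integral>\<^sup>+a. (1 - row_mass g (dyadic (L n)) M2 (f a)) * \<phi> a \<partial>M1) \<longlonglongrightarrow> (\<integral>\<^sup>+a. 0 \<partial>M1)"
  proof (rule nn_integral_dominated_convergence[where w=\<phi>])
    \<comment> \<open>The product with a defect tending to 0 is continuous in the limit only where
      \<phi> is finite.\<close>
    have "AE a in M1. \<phi> a \<noteq> \<top>"
      using nn_integral_PInf_AE[of \<phi> M1] \<phi> by auto
    then show "AE a in M1. (\<lambda>n. (1 - row_mass g (dyadic (L n)) M2 (f a)) * \<phi> a) \<longlonglongrightarrow> 0"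
      using AE_label_positive[OF f]
    proof eventually_elim
      case (elim a)
      then have "(\<lambda>n. row_mass g (dyadic (L n)) M2 (f a)) \<longlonglongrightarrow> 1"
        using rlim[of "f a"] by (simp add: row_cell_density[OF \<gamma>])
      then have "(\<lambda>n. (1 - row_mass g (dyadic (L n)) M2 (f a)) * \<phi> a) \<longlonglongrightarrow> (1 - 1) * \<phi> a"
        using elim by (intro tendsto_mult_ennreal tendsto_diff_ennreal tendsto_const) auto
      then show ?case by simp
    qed
  next
    \<comment> \<open>With an arbitrary weight \<open>c\<close> in place of the row mass, this is
      the domination condition for every index at once.\<close>
    show "AE x in M1. (1 - c (x)) * \<phi> x \<le> \<phi> x" for c :: "_ \<Rightarrow> ennreal"
      by (rule AE_I2) (use mult_right_mono[of "1 - c x" 1 "\<phi> x" for x] in simp)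
  qed (use \<phi> in \<open>auto intro: borel_measurable_times_ennreal borel_measurable_minus_ennreal label_measurable\<close>)
  then have R: "(\<lambda>n. \<integral>\<^sup>+a. (1 - row_mass g (dyadic (L n)) M2 (f a)) * \<phi> a \<partial>M1) \<longlonglongrightarrow> 0" by simp
  have "(\<lambda>n. \<integral>\<^sup>+b. (1 - col_mass f (dyadic (L n)) M1 (g b)) * \<psi> b \<partial>M2) \<longlonglongrightarrow> (\<integral>\<^sup>+b. 0 \<partial>M2)"
  proof (rule nn_integral_dominated_convergence[where w=\<psi>])
    have "AE b in M2. \<psi> b \<noteq> \<top>"
      using nn_integral_PInf_AE[of \<psi> M2] \<psi> by auto
    then show "AE b in M2. (\<lambda>n. (1 - col_mass f (dyadic (L n)) M1 (g b)) * \<psi> b) \<longlonglongrightarrow> 0"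
      using AE_label_positive[OF g]
    proof eventually_elim
      case (elim b)
      then have "(\<lambda>n. col_mass f (dyadic (L n)) M1 (g b)) \<longlonglongrightarrow> 1"
        using clim[of "g b"] by (simp add: col_cell_density[OF \<gamma>])
      then have "(\<lambda>n. (1 - col_mass f (dyadic (L n)) M1 (g b)) * \<psi> b) \<longlonglongrightarrow> (1 - 1) * \<psi> b"
        using elim by (intro tendsto_mult_ennreal tendsto_diff_ennreal tendsto_const) auto
      then show ?case by simp
    qed
  next
    show "AE x in M2. (1 - c (x)) * \<psi> x \<le> \<psi> x" for c :: "_ \<Rightarrow> ennreal"
      by (rule AE_I2) (use mult_right_mono[of "1 - c x" 1 "\<psi> x" for x] in simp)
  qed (use \<psi> in \<open>auto intro: borel_measurable_times_ennreal borel_measurable_minus_ennreal label_measurable\<close>)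
  then have S: "(\<lambda>n. \<integral>\<^sup>+b. (1 - col_mass f (dyadic (L n)) M1 (g b)) * \<psi> b \<partial>M2) \<longlonglongrightarrow> 0" by simp
  have "(\<lambda>n. (\<integral>\<^sup>+a. (1 - row_mass g (dyadic (L n)) M2 (f a)) * \<phi> a \<partial>M1)
      + (\<integral>\<^sup>+b. (1 - col_mass f (dyadic (L n)) M1 (g b)) * \<psi> b \<partial>M2)) \<longlonglongrightarrow> 0"
    using tendsto_add[OF R S] by simp
  then have "\<forall>\<^sub>F n in sequentially. (\<integral>\<^sup>+a. (1 - row_mass g (dyadic (L n)) M2 (f a)) * \<phi> a \<partial>M1)
      + (\<integral>\<^sup>+b. (1 - col_mass f (dyadic (L n)) M1 (g b)) * \<psi> b \<partial>M2) < ennreal e"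
    using e by (intro order_tendstoD) auto
  then obtain n where n: "(\<integral>\<^sup>+a. (1 - row_mass g (dyadic (L n)) M2 (f a)) * \<phi> a \<partial>M1)
      + (\<integral>\<^sup>+b. (1 - col_mass f (dyadic (L n)) M1 (g b)) * \<psi> b \<partial>M2) < ennreal e"
    by (auto simp: eventually_sequentially)
  show thesis
  proof (rule that[OF adm[of n]])
    \<comment> \<open>The rounded density lies below the cell density pointwise, so only the
      filled-up mass can add to the cost.\<close>
    have u: "(\<integral>\<^sup>+p. dyadic (L n) (f (fst p)) (g (snd p)) * d p \<partial>(M1 \<Otimes>\<^sub>M M2))
       \<le> (\<integral>\<^sup>+p. ?c (f (fst p)) (g (snd p)) * d p \<partial>(M1 \<Otimes>\<^sub>M M2))"
      by (intro nn_integral_mono mult_right_mono le') simp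
    show "(\<integral>\<^sup>+p. fill_density f g (dyadic (L n)) M1 M2 p * d p \<partial>(M1 \<Otimes>\<^sub>M M2))
      \<le> (\<integral>\<^sup>+p. ?c (f (fst p)) (g (snd p)) * d p \<partial>(M1 \<Otimes>\<^sub>M M2)) + ennreal e"
      by (rule order_trans[OF nn_integral_fill_le[OF adm assms(2-4) d]])
        (use add_mono[OF u less_imp_le[OF n]] in \<open>simp_all add: add.assoc\<close>)
  qed
qed

end

section \<open>Partitions into small cells and kernels given by densities\<close>

lemma ex_small_cells:
  fixes \<delta> :: real
  assumes "0 < \<delta>"
  obtains f :: "'a::polish_space \<Rightarrow> nat" and c :: "nat \<Rightarrow> 'a"
  where "f \<in> borel \<rightarrow>\<^sub>M count_space UNIV" "\<And>a. dist a (c (f a)) < \<delta>"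
proof -
  obtain D :: "'a set" where D: "countable D" "\<And>X. open X \<Longrightarrow> X \<noteq> {} \<Longrightarrow> \<exists>d\<in>D. d \<in> X"
    using countable_dense_setE by blast
  define c where "c = from_nat_into D"
  have "D \<noteq> {}" using D(2)[of UNIV] by auto
  have ex: "\<exists>n. dist a (c n) < \<delta>" for a
  proof -
    obtain d where "d \<in> D" "d \<in> ball a \<delta>"
      using D(2)[of "ball a \<delta>"] assms by auto
    then show ?thesis
      using from_nat_into_surj[OF D(1)] by (auto simp: c_def)
  qed
  show thesis
  proof
    \<comment> \<open>A cell collects the points whose first close enough element, in an enumeration
      of a countable dense set, has a given index; that element serves as the centre of the
      cell.\<close>
    show "(\<lambda>a. LEAST n. dist a (c n) < \<delta>) \<in> borel \<rightarrow>\<^sub>M count_space UNIV"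
      by (rule measurable_Least) measurable
    show "dist a (c (LEAST n. dist a (c n) < \<delta>)) < \<delta>" for a
      by (rule LeastI_ex) (rule ex)
  qed
qed

lemma measurable_density_prob_algebra:
  assumes \<kappa>[measurable]: "\<kappa> \<in> M \<rightarrow>\<^sub>M subprob_algebra N"
    and w[measurable]: "(\<lambda>(z, x). w z x) \<in> borel_measurable (M \<Otimes>\<^sub>M N)"
    and prob: "\<And>z. z \<in> space M \<Longrightarrow> prob_space (density (\<kappa> z) (w z))"
  shows "(\<lambda>z. density (\<kappa> z) (w z)) \<in> M \<rightarrow>\<^sub>M prob_algebra N"
proof (intro measurable_prob_algebraI measurable_subprob_algebra)
  fix X assume [measurable]: "X \<in> sets N"
  have "(\<lambda>z. \<integral>\<^sup>+x. w z x * indicator X x \<partial>\<kappa> z) \<in> borel_measurable M"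
    by (rule nn_integral_measurable_subprob_algebra2[OF _ \<kappa>]) measurable
  moreover have "emeasure (density (\<kappa> z) (w z)) X = (\<integral>\<^sup>+x. w z x * indicator X x \<partial>\<kappa> z)" if z: "z \<in> space M" for z
  proof (rule emeasure_density)
    show "w z \<in> borel_measurable (\<kappa> z)"
      using measurable_Pair2[OF w z] by (simp add: measurable_cong_sets[OF sets_kernel[OF \<kappa> z] refl])
    show "X \<in> sets (\<kappa> z)" by (simp add: sets_kernel[OF \<kappa> z])
  qed
  ultimately show "(\<lambda>z. emeasure (density (\<kappa> z) (w z)) X) \<in> borel_measurable M"
    by (simp cong: measurable_cong)
qed (auto simp: prob sets_kernel[OF \<kappa>] intro: prob_space_imp_subprob_space)

subsection \<open>Measurable selection of near-optimal couplings\<close>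

text \<open>For a fixed matrix \<open>U\<close> the row, column and total masses are integrals
  against kernels and so measurable in the parameter. Composing with a label keeps joint
  measurability because labels take countably many values.\<close>

lemma measurable_step_coupling:
  assumes \<kappa>[measurable]: "\<kappa> \<in> M \<rightarrow>\<^sub>M prob_algebra N" and \<kappa>'[measurable]: "\<kappa>' \<in> M \<rightarrow>\<^sub>M prob_algebra N'"
    and f[measurable]: "f \<in> N \<rightarrow>\<^sub>M count_space UNIV" and g[measurable]: "g \<in> N' \<rightarrow>\<^sub>M count_space UNIV"
  shows "(\<lambda>z. step_coupling f g U (\<kappa> z) (\<kappa>' z)) \<in> M \<rightarrow>\<^sub>M prob_algebra (N \<Otimes>\<^sub>M N')"
    and "z \<in> space M \<Longrightarrow> step_coupling f g U (\<kappa> z) (\<kappa>' z) \<in> couplings (\<kappa> z) (\<kappa>' z)"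
proof -
  note \<kappa>s = measurable_prob_algebraD[OF \<kappa>] and \<kappa>s' = measurable_prob_algebraD[OF \<kappa>']
  have lp: "labelled_pair (\<kappa> z) (\<kappa>' z) f g" if z: "z \<in> space M" for z
  proof -
    have "prob_space (\<kappa> z)" "prob_space (\<kappa>' z)" "sets (\<kappa> z) = sets N" "sets (\<kappa>' z) = sets N'"
      using measurable_space[OF \<kappa> z] measurable_space[OF \<kappa>' z] by (auto simp: space_prob_algebra)
    then show ?thesis
      using f g by (auto simp: labelled_pair_def labelled_pair_axioms_def pair_prob_space_def
          pair_sigma_finite_def prob_space_imp_sigma_finite cong: measurable_cong_sets)
  qed
  show coupling: "step_coupling f g U (\<kappa> z) (\<kappa>' z) \<in> couplings (\<kappa> z) (\<kappa>' z)" if "z \<in> space M" for z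
    using lp[OF that] by (rule labelled_pair.step_coupling_couplings)
  have row: "(\<lambda>z. row_mass g U (\<kappa>' z) k) \<in> borel_measurable M" for k
    unfolding row_mass_def
    by (rule measurable_compose[OF \<kappa>s' nn_integral_measurable_subprob_algebra])
      (rule measurable_compose[OF g], simp)
  have col: "(\<lambda>z. col_mass f U (\<kappa> z) l) \<in> borel_measurable M" for l
    unfolding col_mass_def
    by (rule measurable_compose[OF \<kappa>s nn_integral_measurable_subprob_algebra])
      (rule measurable_compose[OF f], simp)
  have rowf: "(\<lambda>(z, a). row_mass g U (\<kappa>' z) (f a)) \<in> borel_measurable (M \<Otimes>\<^sub>M N)"
    unfolding case_prod_beta'
    by (rule measurable_compose_countable[OF measurable_compose[OF measurable_fst row]]) measurable
  have tot: "(\<lambda>z. total_mass f g U (\<kappa> z) (\<kappa>' z)) \<in> borel_measurable M"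
    unfolding total_mass_def by (rule nn_integral_measurable_subprob_algebra2[OF rowf \<kappa>s])
  have adm: "Measurable.pred M (\<lambda>z. admissible f g U (\<kappa> z) (\<kappa>' z))"
    unfolding admissible_def using row col tot by measurable
  have rowp: "(\<lambda>x. row_mass g U (\<kappa>' (fst x)) (f (fst (snd x)))) \<in> borel_measurable (M \<Otimes>\<^sub>M (N \<Otimes>\<^sub>M N'))"
    by (rule measurable_compose_countable[OF measurable_compose[OF measurable_fst row]]) measurable
  have colp: "(\<lambda>x. col_mass f U (\<kappa> (fst x)) (g (snd (snd x)))) \<in> borel_measurable (M \<Otimes>\<^sub>M (N \<Otimes>\<^sub>M N'))"
    by (rule measurable_compose_countable[OF measurable_compose[OF measurable_fst col]]) measurable
  have totp: "(\<lambda>x. total_mass f g U (\<kappa> (fst x)) (\<kappa>' (fst x))) \<in> borel_measurable (M \<Otimes>\<^sub>M (N \<Otimes>\<^sub>M N'))"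
    by (rule measurable_compose[OF measurable_fst tot])
  have Up: "(\<lambda>x. U (f (fst (snd x))) (g (snd (snd x)))) \<in> borel_measurable (M \<Otimes>\<^sub>M (N \<Otimes>\<^sub>M N'))"
    by (rule measurable_compose_countable[where f="\<lambda>k x. U k (g (snd (snd x)))"],
        rule measurable_compose_countable) measurable
  have fill: "(\<lambda>x. fill_density f g U (\<kappa> (fst x)) (\<kappa>' (fst x)) (snd x)) \<in> borel_measurable (M \<Otimes>\<^sub>M (N \<Otimes>\<^sub>M N'))"
    unfolding fill_density_def
    by (intro borel_measurable_add borel_measurable_times_ennreal borel_measurable_divide_ennreal
      borel_measurable_minus_ennreal borel_measurable_const Up rowp colp totp)
  show "(\<lambda>z. step_coupling f g U (\<kappa> z) (\<kappa>' z)) \<in> M \<rightarrow>\<^sub>M prob_algebra (N \<Otimes>\<^sub>M N')"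
    unfolding step_coupling_def
  proof (rule measurable_density_prob_algebra)
    show "(\<lambda>z. \<kappa> z \<Otimes>\<^sub>M \<kappa>' z) \<in> M \<rightarrow>\<^sub>M subprob_algebra (N \<Otimes>\<^sub>M N')"
      by (intro measurable_prob_algebraD measurable_pair_prob \<kappa> \<kappa>')
    show "(\<lambda>(z, p). if admissible f g U (\<kappa> z) (\<kappa>' z) then fill_density f g U (\<kappa> z) (\<kappa>' z) p else 1)
        \<in> borel_measurable (M \<Otimes>\<^sub>M (N \<Otimes>\<^sub>M N'))"
      unfolding case_prod_beta'
      by (intro measurable_If fill measurable_const measurable_compose[OF measurable_fst adm, unfolded pred_def]) simp
    fix z assume z: "z \<in> space M"
    then have "prob_space (\<kappa> z)"
      using measurable_space[OF \<kappa> z] by (auto simp: space_prob_algebra)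
    with coupling[OF z] show "prob_space (density (\<kappa> z \<Otimes>\<^sub>M \<kappa>' z)
        (\<lambda>p. if admissible f g U (\<kappa> z) (\<kappa>' z) then fill_density f g U (\<kappa> z) (\<kappa>' z) p else 1))"
      unfolding step_coupling_def by (rule couplings_prob_space)
  qed
qed

text \<open>A coupling of cost below \<open>w\<close> is averaged over cells whose points lie within
  \<delta> of a centre, then rounded and filled up. Passing from points to centres and back costs at
  most \<open>4 * \<delta>\<close>, rounding and filling at most one further \<delta>.\<close>

lemma ex_near_optimal_step_coupling:
  fixes \<mu> \<nu> :: "'a::polish_space measure" and f :: "'a \<Rightarrow> nat"
  assumes prob: "prob_space \<mu>" "prob_space \<nu>" and sets: "sets \<mu> = sets borel" "sets \<nu> = sets borel"
    and f: "f \<in> borel \<rightarrow>\<^sub>M count_space UNIV" and c: "\<And>a. dist a (c (f a)) < \<delta>"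
    and m: "(\<integral>\<^sup>+a. dist o' a \<partial>\<mu>) < \<top>" "(\<integral>\<^sup>+a. dist o' a \<partial>\<nu>) < \<top>"
    and w: "wasserstein1 dist \<mu> \<nu> < w"
  shows "\<exists>L. (\<integral>\<^sup>+p. dist (fst p) (snd p) \<partial>step_coupling f f (dyadic L) \<mu> \<nu>) \<le> w + ennreal (5 * \<delta>)"
proof -
  have fm: "f \<in> \<mu> \<rightarrow>\<^sub>M count_space UNIV" "f \<in> \<nu> \<rightarrow>\<^sub>M count_space UNIV"
    using f sets by (auto cong: measurable_cong_sets)
  interpret labelled_pair \<mu> \<nu> f f
    using prob fm by (auto simp: labelled_pair_def labelled_pair_axioms_def pair_prob_space_def
          pair_sigma_finite_def prob_space_imp_sigma_finite)
  have \<delta>: "0 < \<delta>" using c[of undefined] zero_le_dist le_less_trans by blast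
  obtain \<gamma> where \<gamma>: "\<gamma> \<in> couplings \<mu> \<nu>" and cost: "(\<integral>\<^sup>+p. dist (fst p) (snd p) \<partial>\<gamma>) < w"
    using w by (auto simp: wasserstein1_def INF_less_iff)
  have d: "(\<lambda>p. ennreal (dist (fst p) (snd p))) \<in> borel_measurable (\<mu> \<Otimes>\<^sub>M \<nu>)"
    unfolding measurable_cong_sets[OF sets_pair_measure_cong[OF sets] refl] by measurable
  have o: "(\<lambda>a. ennreal (dist o' a)) \<in> borel_measurable \<mu>" "(\<lambda>a. ennreal (dist o' a)) \<in> borel_measurable \<nu>"
    by (simp_all add: measurable_cong_sets[OF sets(1) refl] measurable_cong_sets[OF sets(2) refl])
  obtain L where L: "admissible f f (dyadic L) \<mu> \<nu>"
    and le: "(\<integral>\<^sup>+p. fill_density f f (dyadic L) \<mu> \<nu> p * ennreal (dist (fst p) (snd p)) \<partial>(\<mu> \<Otimes>\<^sub>M \<nu>))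
      \<le> (\<integral>\<^sup>+p. cell_density f f \<gamma> \<mu> \<nu> (f (fst p)) (f (snd p)) * ennreal (dist (fst p) (snd p)) \<partial>(\<mu> \<Otimes>\<^sub>M \<nu>)) + ennreal \<delta>"
    \<comment> \<open>The bounds \<phi> and \<psi> are both the distance to the reference point
      \<open>o'\<close>; they dominate the cost by the triangle inequality and have finite integrals
      by the moment assumptions.\<close>
    by (rule ex_dyadic_fill[OF \<gamma> d o _ m \<delta>])
      (auto simp flip: ennreal_plus intro!: ennreal_leI dist_triangle3)
  \<comment> \<open>A majorant of the distance that depends on the labels only, so that its integral
    under the averaged coupling equals its integral under \<gamma>.\<close>
  define h where "h k l = ennreal (dist (c k) (c l) + 2 * \<delta>)" for k l
  have hm: "(\<lambda>p. h (f (fst p)) (f (snd p))) \<in> borel_measurable \<gamma>"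
    using label_compose_pair[of h] by (simp add: measurable_cong_sets[OF sets_gamma[OF \<gamma>] refl])
  have dm: "(\<lambda>p. ennreal (dist (fst p) (snd p))) \<in> borel_measurable \<gamma>"
    using d by (simp add: measurable_cong_sets[OF sets_gamma[OF \<gamma>] refl])
  have "(\<integral>\<^sup>+p. cell_density f f \<gamma> \<mu> \<nu> (f (fst p)) (f (snd p)) * ennreal (dist (fst p) (snd p)) \<partial>(\<mu> \<Otimes>\<^sub>M \<nu>))
     \<le> (\<integral>\<^sup>+p. cell_density f f \<gamma> \<mu> \<nu> (f (fst p)) (f (snd p)) * h (f (fst p)) (f (snd p)) \<partial>(\<mu> \<Otimes>\<^sub>M \<nu>))"
  proof (intro nn_integral_mono mult_left_mono)
    fix p :: "'a \<times> 'a"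
    have "dist (fst p) (snd p) \<le> dist (c (f (fst p))) (c (f (snd p))) + 2 * \<delta>"
      using c[of "fst p"] c[of "snd p"] dist_triangle[of "fst p" "snd p" "c (f (fst p))"]
        dist_triangle2[of "c (f (fst p))" "snd p" "c (f (snd p))"] by linarith
    then show "ennreal (dist (fst p) (snd p)) \<le> h (f (fst p)) (f (snd p))"
      unfolding h_def by (rule ennreal_leI)
  qed simp
  also have "\<dots> = (\<integral>\<^sup>+p. h (f (fst p)) (f (snd p)) \<partial>\<gamma>)"
    by (rule nn_integral_cell_density[OF \<gamma>])
  also have "\<dots> \<le> (\<integral>\<^sup>+p. ennreal (dist (fst p) (snd p)) + ennreal (4 * \<delta>) \<partial>\<gamma>)"
  proof (intro nn_integral_mono)
    fix p :: "'a \<times> 'a"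
    have "dist (c (f (fst p))) (c (f (snd p))) + 2 * \<delta> \<le> dist (fst p) (snd p) + 4 * \<delta>"
      using c[of "fst p"] c[of "snd p"] dist_triangle3[of "c (f (fst p))" "c (f (snd p))" "fst p"]
        dist_triangle[of "fst p" "c (f (snd p))" "snd p"] by linarith
    then show "h (f (fst p)) (f (snd p)) \<le> ennreal (dist (fst p) (snd p)) + ennreal (4 * \<delta>)"
      using \<delta> by (simp add: h_def ennreal_leI flip: ennreal_plus)
  qed
  also have "\<dots> = (\<integral>\<^sup>+p. ennreal (dist (fst p) (snd p)) \<partial>\<gamma>) + ennreal (4 * \<delta>)"
    using couplings_prob_space[OF \<gamma> prob(1)]
    by (subst nn_integral_add) (auto simp: dm prob_space.emeasure_space_1)
  also have "\<dots> \<le> w + ennreal (4 * \<delta>)"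
    using cost by (intro add_right_mono) simp
  finally have "(\<integral>\<^sup>+p. fill_density f f (dyadic L) \<mu> \<nu> p * ennreal (dist (fst p) (snd p)) \<partial>(\<mu> \<Otimes>\<^sub>M \<nu>))
      \<le> w + ennreal (4 * \<delta>) + ennreal \<delta>"
    using le by (meson add_right_mono order_trans)
  also have "\<dots> = w + ennreal (5 * \<delta>)"
    using \<delta> by (simp add: add.assoc flip: ennreal_plus)
  finally show ?thesis
    using L by (intro exI[of _ L]) (simp add: step_coupling_def nn_integral_density d)
qed

text \<open>Countably many measurable families of couplings contain a good one for every parameter.
  Being good is a measurable condition, so taking the first good index is a measurable
  choice.\<close>

lemma near_optimal_coupling_kernel:
  fixes \<kappa> \<kappa>' :: "'z \<Rightarrow> 'a::polish_space measure"
  assumes \<kappa>: "\<kappa> \<in> M \<rightarrow>\<^sub>M prob_algebra borel" and \<kappa>': "\<kappa>' \<in> M \<rightarrow>\<^sub>M prob_algebra borel"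
    and c[measurable]: "c \<in> borel_measurable M" and cfin: "\<And>z. z \<in> space M \<Longrightarrow> c z < \<top>"
    and W: "\<And>z. z \<in> space M \<Longrightarrow> wasserstein1 dist (\<kappa> z) (\<kappa>' z) \<le> c z"
    and m: "\<And>z. z \<in> space M \<Longrightarrow> (\<integral>\<^sup>+a. dist o' a \<partial>\<kappa> z) < \<top>"
    and m': "\<And>z. z \<in> space M \<Longrightarrow> (\<integral>\<^sup>+a. dist o' a \<partial>\<kappa>' z) < \<top>"
    and \<epsilon>: "0 < (\<epsilon> :: real)"
  obtains Q where "Q \<in> M \<rightarrow>\<^sub>M prob_algebra (borel \<Otimes>\<^sub>M borel)"
    and "\<And>z. z \<in> space M \<Longrightarrow> Q z \<in> couplings (\<kappa> z) (\<kappa>' z)"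
    and "\<And>z. z \<in> space M \<Longrightarrow> (\<integral>\<^sup>+p. dist (fst p) (snd p) \<partial>Q z) \<le> c z + ennreal \<epsilon>"
proof -
  \<comment> \<open>Half of \<epsilon> is spent on a strict bound for the Wasserstein distance; the
    other half is the error of five cell radii.\<close>
  have "0 < \<epsilon> / 10" using \<epsilon> by simp
  then obtain f :: "'a \<Rightarrow> nat" and x where f: "f \<in> borel \<rightarrow>\<^sub>M count_space UNIV" and x: "\<And>a. dist a (x (f a)) < \<epsilon> / 10"
    by (rule ex_small_cells) blast
  define q where "q n z = step_coupling f f (dyadic (from_nat n)) (\<kappa> z) (\<kappa>' z)" for n z
  have q: "q n \<in> M \<rightarrow>\<^sub>M prob_algebra (borel \<Otimes>\<^sub>M borel)" for n
    using measurable_step_coupling(1)[OF \<kappa> \<kappa>' f f] by (simp add: q_def[abs_def])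
  have qc: "q n z \<in> couplings (\<kappa> z) (\<kappa>' z)" if "z \<in> space M" for n z
    using measurable_step_coupling(2)[OF \<kappa> \<kappa>' f f that] by (simp add: q_def)
  define good where "good n z \<longleftrightarrow> (\<integral>\<^sup>+p. dist (fst p) (snd p) \<partial>q n z) \<le> c z + ennreal \<epsilon>" for n z
  have ex: "\<exists>n. good n z" if z: "z \<in> space M" for z
  proof -
    \<comment> \<open>A coupling of cost below a bound exists only when the infimum is strictly
      smaller; finiteness of \<open>c z\<close> makes adding \<open>\<epsilon> / 2\<close> a strict
      increase.\<close>
    have "wasserstein1 dist (\<kappa> z) (\<kappa>' z) < c z + ennreal (\<epsilon> / 2)"
      using ennreal_add_left_cancel_less[of "c z" 0 "ennreal (\<epsilon> / 2)"] cfin[OF z] \<epsilon>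
      by (intro le_less_trans[OF W[OF z]]) simp
    then have "\<exists>L. (\<integral>\<^sup>+p. dist (fst p) (snd p) \<partial>step_coupling f f (dyadic L) (\<kappa> z) (\<kappa>' z))
        \<le> c z + ennreal (\<epsilon> / 2) + ennreal (5 * (\<epsilon> / 10))"
      using measurable_space[OF \<kappa> z] measurable_space[OF \<kappa>' z] z
      by (intro ex_near_optimal_step_coupling[where c=x and o'=o'] f x m m') (auto simp: space_prob_algebra)
    then obtain L where "(\<integral>\<^sup>+p. dist (fst p) (snd p) \<partial>step_coupling f f (dyadic L) (\<kappa> z) (\<kappa>' z))
        \<le> c z + ennreal (\<epsilon> / 2) + ennreal (5 * (\<epsilon> / 10))" ..
    also have "\<dots> = c z + ennreal \<epsilon>"
      using \<epsilon> by (simp add: add.assoc flip: ennreal_plus)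
    finally show ?thesis
      by (intro exI[of _ "to_nat L"]) (simp add: good_def q_def)
  qed
  have good: "Measurable.pred M (good n)" for n
  proof -
    have [measurable]: "(\<lambda>z. \<integral>\<^sup>+p. dist (fst p) (snd p) \<partial>q n z) \<in> borel_measurable M"
      by (rule nn_integral_measurable_subprob_algebra2[OF _ measurable_prob_algebraD[OF q]])
        (simp add: case_prod_beta')
    show ?thesis unfolding good_def[abs_def] by measurable
  qed
  show thesis
  proof
    show "(\<lambda>z. q (LEAST n. good n z) z) \<in> M \<rightarrow>\<^sub>M prob_algebra (borel \<Otimes>\<^sub>M borel)"
      by (rule measurable_compose_countable[OF q measurable_Least[OF good]])
    show "(\<integral>\<^sup>+p. dist (fst p) (snd p) \<partial>q (LEAST n. good n z) z) \<le> c z + ennreal \<epsilon>" if "z \<in> space M" for z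
      using LeastI_ex[OF ex[OF that]] by (simp add: good_def)
  qed (rule qc)
qed

subsection \<open>Glauber updates and first moments\<close>

text \<open>Only the \<sigma>-algebra of the target matters for an image measure, so the marginals
  can be taken on fixed reference spaces.\<close>

lemma couplings_iff:
  assumes "sets \<mu> = sets M" "sets \<nu> = sets N"
  shows "\<gamma> \<in> couplings \<mu> \<nu> \<longleftrightarrow> sets \<gamma> = sets (M \<Otimes>\<^sub>M N) \<and> distr \<gamma> M fst = \<mu> \<and> distr \<gamma> N snd = \<nu>"
proof -
  have "distr \<gamma> \<mu> fst = distr \<gamma> M fst" "distr \<gamma> \<nu> snd = distr \<gamma> N snd"
    using assms by (auto intro: distr_cong)
  then show ?thesis
    using sets_pair_measure_cong[OF assms] by (simp add: couplings_def)
qed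

text \<open>Along a coupling of finite cost, the triangle inequality bounds the second moment
  integral by the first one plus the cost.\<close>

lemma nn_integral_dist_coupling_finite:
  fixes \<mu> \<nu> :: "'a::polish_space measure"
  assumes sets: "sets \<mu> = sets borel" "sets \<nu> = sets borel"
    and W: "wasserstein1 dist \<mu> \<nu> < \<top>" and fin: "(\<integral>\<^sup>+a. dist o' a \<partial>\<mu>) < \<top>"
  shows "(\<integral>\<^sup>+a. dist o' a \<partial>\<nu>) < \<top>"
proof -
  obtain \<gamma> where \<gamma>: "\<gamma> \<in> couplings \<mu> \<nu>" and cost: "(\<integral>\<^sup>+p. dist (fst p) (snd p) \<partial>\<gamma>) < \<top>"
    using W by (auto simp: wasserstein1_def INF_less_iff)
  have s: "sets \<gamma> = sets (borel \<Otimes>\<^sub>M borel)"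
    using \<gamma> by (simp add: couplings_iff[OF sets])
  have h: "(\<lambda>a. ennreal (dist o' a)) \<in> borel_measurable M" if "sets M = sets borel" for M
    by (simp add: measurable_cong_sets[OF that refl])
  have "(\<integral>\<^sup>+a. dist o' a \<partial>\<nu>) = (\<integral>\<^sup>+p. dist o' (snd p) \<partial>\<gamma>)"
    by (rule nn_integral_coupling_snd[symmetric, OF \<gamma> h[OF sets(2)]])
  also have "\<dots> \<le> (\<integral>\<^sup>+p. ennreal (dist o' (fst p)) + ennreal (dist (fst p) (snd p)) \<partial>\<gamma>)"
    by (intro nn_integral_mono) (auto simp flip: ennreal_plus intro!: ennreal_leI dist_triangle)
  also have "\<dots> = (\<integral>\<^sup>+p. ennreal (dist o' (fst p)) \<partial>\<gamma>) + (\<integral>\<^sup>+p. ennreal (dist (fst p) (snd p)) \<partial>\<gamma>)"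
    by (rule nn_integral_add) (simp_all add: measurable_cong_sets[OF s refl])
  also have "\<dots> < \<top>"
    using cost fin nn_integral_coupling_fst[OF \<gamma> h[OF sets(1)]] by simp
  finally show ?thesis .
qed

lemma bind_in_prob_algebra:
  "m \<in> space (prob_algebra M) \<Longrightarrow> f \<in> M \<rightarrow>\<^sub>M prob_algebra M' \<Longrightarrow> m \<bind> f \<in> space (prob_algebra M')"
  by (simp add: space_prob_algebra prob_space_bind' sets_bind')

locale glauber_kernels =
  fixes N :: nat and K :: "nat \<Rightarrow> (nat \<Rightarrow> 'a::polish_space) \<Rightarrow> 'a measure"
  assumes kernel: "i < N \<Longrightarrow> K i \<in> config_except N i \<rightarrow>\<^sub>M prob_algebra borel"
begin

abbreviation "C \<equiv> config N :: (nat \<Rightarrow> 'a) measure"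
abbreviation "G \<equiv> glauber_update N K"

lemma measurable_component: "j < N \<Longrightarrow> (\<lambda>x. x j) \<in> C \<rightarrow>\<^sub>M borel"
  unfolding config_def by (rule measurable_component_singleton) simp

lemma measurable_dist_component[measurable]:
  "j < N \<Longrightarrow> (\<lambda>p. dist (fst p j) (snd p j)) \<in> borel_measurable (C \<Otimes>\<^sub>M C)"
  by (intro borel_measurable_dist measurable_compose[OF measurable_fst measurable_component]
      measurable_compose[OF measurable_snd measurable_component])

lemma measurable_drop_coord: "drop_coord N i \<in> C \<rightarrow>\<^sub>M config_except N i"
  unfolding config_def config_except_def drop_coord_def[abs_def]
  by (rule measurable_restrict_subset) (auto simp: others_def)

lemma measurable_coordinate_kernel: "i < N \<Longrightarrow> (\<lambda>x. K i (drop_coord N i x)) \<in> C \<rightarrow>\<^sub>M prob_algebra borel"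
  by (rule measurable_compose[OF measurable_drop_coord kernel])

lemma measurable_fun_upd_config: "i < N \<Longrightarrow> (\<lambda>(x, a). x(i := a)) \<in> C \<Otimes>\<^sub>M borel \<rightarrow>\<^sub>M C"
  using measurable_add_dim[of i "{..<N}" "\<lambda>_. borel"] by (simp add: config_def insert_absorb)

lemma measurable_fun_upd_config1: "i < N \<Longrightarrow> x \<in> space C \<Longrightarrow> (\<lambda>a. x(i := a)) \<in> borel \<rightarrow>\<^sub>M C"
  using measurable_Pair2[OF measurable_fun_upd_config] by simp

lemma measurable_glauber_update: "i < N \<Longrightarrow> G i \<in> C \<rightarrow>\<^sub>M prob_algebra C"
  unfolding glauber_update_def[abs_def]
  by (rule measurable_distr_prob_space2[OF measurable_coordinate_kernel measurable_fun_upd_config])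

lemma measurable_glauber_update': "i < N \<Longrightarrow> G i \<in> C \<rightarrow>\<^sub>M subprob_algebra C"
  by (rule measurable_prob_algebraD[OF measurable_glauber_update])

lemma nn_integral_glauber_update:
  assumes i: "i < N" and x: "x \<in> space C" and h: "h \<in> borel_measurable C"
  shows "(\<integral>\<^sup>+y. h y \<partial>G i x) = (\<integral>\<^sup>+a. h (x(i := a)) \<partial>K i (drop_coord N i x))"
proof -
  have "sets (K i (drop_coord N i x)) = sets borel"
    using measurable_space[OF measurable_coordinate_kernel[OF i] x] by (simp add: space_prob_algebra)
  then show ?thesis
    unfolding glauber_update_def
    using measurable_fun_upd_config1[OF i x] h by (subst nn_integral_distr) (auto cong: measurable_cong_sets)
qed

text \<open>The first \<open>n\<close> updates of a sweep, started from an arbitrary law. This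
  allows induction over the updates, and for \<open>n = N\<close> and a point mass it is one step of
  the chain.\<close>

definition partial_scan :: "nat \<Rightarrow> (nat \<Rightarrow> 'a) measure \<Rightarrow> (nat \<Rightarrow> 'a) measure" where
  "partial_scan n m = foldl (\<lambda>m i. m \<bind> G i) m [0..<n]"

lemma partial_scan_0[simp]: "partial_scan 0 m = m"
  and partial_scan_Suc[simp]: "partial_scan (Suc n) m = partial_scan n m \<bind> G n"
  by (simp_all add: partial_scan_def)

lemma partial_scan_in: "m \<in> space (prob_algebra C) \<Longrightarrow> n \<le> N \<Longrightarrow> partial_scan n m \<in> space (prob_algebra C)"
  by (induction n) (simp_all add: bind_in_prob_algebra measurable_glauber_update)

lemma measurable_partial_scan_return:
  "n \<le> N \<Longrightarrow> (\<lambda>x. partial_scan n (return C x)) \<in> C \<rightarrow>\<^sub>M prob_algebra C"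
  by (induction n) (simp_all add: measurable_bind_prob_space[OF _ measurable_glauber_update])

lemma measurable_systemic_scan: "systemic_scan N K \<in> C \<rightarrow>\<^sub>M prob_algebra C"
  using measurable_partial_scan_return[of N] by (simp add: partial_scan_def systemic_scan_def[abs_def])

text \<open>Associativity of \<open>bind\<close>: mixing the scans started at points over the law
  \<open>m\<close> is the same as scanning \<open>m\<close> itself. So a step of the chain from any
  law can be analysed one update at a time.\<close>

lemma bind_partial_scan:
  assumes m: "m \<in> space (prob_algebra C)"
  shows "n \<le> N \<Longrightarrow> m \<bind> (\<lambda>x. partial_scan n (return C x)) = partial_scan n m"
proof (induction n)
  case 0
  have "sets m = sets C" using m by (simp add: space_prob_algebra)
  then show ?case by (simp add: bind_return'')
next
  case (Suc n)
  have s: "sets m = sets C" using m by (simp add: space_prob_algebra)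
  have "(\<lambda>x. partial_scan n (return C x)) \<in> m \<rightarrow>\<^sub>M subprob_algebra C"
    using measurable_prob_algebraD[OF measurable_partial_scan_return[of n]] Suc.prems
    by (simp add: measurable_cong_sets[OF s refl])
  then have "m \<bind> (\<lambda>x. partial_scan n (return C x) \<bind> G n) = (m \<bind> (\<lambda>x. partial_scan n (return C x))) \<bind> G n"
    using measurable_glauber_update'[of n] Suc.prems by (intro bind_assoc[symmetric]) auto
  then show ?case using Suc by simp
qed

lemma bind_systemic_scan: "m \<in> space (prob_algebra C) \<Longrightarrow> m \<bind> systemic_scan N K = partial_scan N m"
  using bind_partial_scan[of m N] by (simp add: systemic_scan_def[abs_def] partial_scan_def)

lemma nn_integral_bind_glauber:
  assumes m: "m \<in> space (prob_algebra C)" and i: "i < N" and h: "h \<in> borel_measurable C"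
  shows "(\<integral>\<^sup>+y. h y \<partial>(m \<bind> G i)) = (\<integral>\<^sup>+x. \<integral>\<^sup>+a. h (x(i := a)) \<partial>K i (drop_coord N i x) \<partial>m)"
proof -
  have s: "sets m = sets C" using m by (simp add: space_prob_algebra)
  have "(\<integral>\<^sup>+y. h y \<partial>(m \<bind> G i)) = (\<integral>\<^sup>+x. \<integral>\<^sup>+y. h y \<partial>G i x \<partial>m)"
    using measurable_glauber_update'[OF i] by (intro nn_integral_bind[OF h]) (simp add: measurable_cong_sets[OF s refl])
  also have "\<dots> = (\<integral>\<^sup>+x. \<integral>\<^sup>+a. h (x(i := a)) \<partial>K i (drop_coord N i x) \<partial>m)"
    using sets_eq_imp_space_eq[OF s] by (intro nn_integral_cong nn_integral_glauber_update i h) simp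
  finally show ?thesis .
qed

lemma prob_space_coordinate_kernel: "i < N \<Longrightarrow> x \<in> space C \<Longrightarrow> prob_space (K i (drop_coord N i x))"
  and sets_coordinate_kernel: "i < N \<Longrightarrow> x \<in> space C \<Longrightarrow> sets (K i (drop_coord N i x)) = sets borel"
  using measurable_space[OF measurable_coordinate_kernel] by (auto simp: space_prob_algebra)

text \<open>Coordinate \<open>i\<close> is redrawn exactly at stage \<open>i\<close>, and the later
  updates touch other coordinates. Its law is therefore a mixture of conditional distributions over
  the states just before that stage.\<close>

lemma nn_integral_component_partial_scan:
  assumes m: "m \<in> space (prob_algebra C)" and i: "i < N" and h: "h \<in> borel_measurable borel"
    and n: "Suc i \<le> n" "n \<le> N"
  shows "(\<integral>\<^sup>+y. h (y i) \<partial>partial_scan n m) = (\<integral>\<^sup>+x. \<integral>\<^sup>+a. h a \<partial>K i (drop_coord N i x) \<partial>partial_scan i m)"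
  using n
proof (induction n rule: dec_induct)
  case base
  show ?case
    unfolding partial_scan_Suc
    by (subst nn_integral_bind_glauber[OF partial_scan_in[OF m] i measurable_compose[OF measurable_component[OF i] h]])
      (use i in auto)
next
  case (step n)
  have s: "space (partial_scan n m) = space C"
    using partial_scan_in[OF m, of n] step by (auto simp: space_prob_algebra dest: sets_eq_imp_space_eq)
  have "(\<integral>\<^sup>+y. h (y i) \<partial>partial_scan (Suc n) m)
      = (\<integral>\<^sup>+x. \<integral>\<^sup>+a. h ((x(n := a)) i) \<partial>K n (drop_coord N n x) \<partial>partial_scan n m)"
    unfolding partial_scan_Suc
    by (rule nn_integral_bind_glauber[OF partial_scan_in[OF m] _ measurable_compose[OF measurable_component[OF i] h]])
      (use step in auto)
  also have "\<dots> = (\<integral>\<^sup>+x. h (x i) \<partial>partial_scan n m)"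
    using step s by (intro nn_integral_cong)
      (auto simp: prob_space.emeasure_space_1[OF prob_space_coordinate_kernel])
  finally show ?case using step by simp
qed

lemma measurable_config_dist[measurable]: "(\<lambda>p. config_dist N (fst p) (snd p)) \<in> borel_measurable (C \<Otimes>\<^sub>M C)"
  unfolding config_dist_def by (intro borel_measurable_sum measurable_dist_component) simp

text \<open>A finite Wasserstein distance from the point mass at \<open>x\<close> bounds the first
  moment of coordinate \<open>i\<close> after one sweep. That moment is an average of first moments
  of conditional distributions, so one of them is finite, and the Dobrushin bound carries finiteness
  over to all others.\<close>

lemma finite_first_moment:
  assumes A: "dobrushin_matrix N K A" and x: "x \<in> space C"
    and W: "wasserstein1 (config_dist N) (return C x) (systemic_scan N K x) < \<top>"
    and i: "i < N" and y: "y \<in> space C"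
  shows "(\<integral>\<^sup>+a. dist (x i) a \<partial>K i (drop_coord N i y)) < \<top>"
proof -
  let ?P = "systemic_scan N K x"
  have r: "return C x \<in> space (prob_algebra C)"
    using x by (simp add: space_prob_algebra prob_space_return)
  have P: "?P = partial_scan N (return C x)"
    by (simp add: systemic_scan_def partial_scan_def)
  have "?P \<in> space (prob_algebra C)"
    unfolding P by (rule partial_scan_in[OF r]) simp
  then have sP: "sets ?P = sets C" by (simp add: space_prob_algebra)
  obtain \<gamma> where \<gamma>: "\<gamma> \<in> couplings (return C x) ?P"
    and cost: "(\<integral>\<^sup>+p. config_dist N (fst p) (snd p) \<partial>\<gamma>) < \<top>"
    using W by (auto simp: wasserstein1_def INF_less_iff)
  have s: "sets \<gamma> = sets (C \<Otimes>\<^sub>M C)"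
    using \<gamma> couplings_iff[of "return C x" C ?P C] sP by simp
  have hx: "(\<lambda>y. ennreal (dist (x i) (y i))) \<in> borel_measurable C"
    by (rule measurable_compose[OF measurable_component[OF i]]) simp
  have hP: "(\<lambda>y. ennreal (dist (x i) (y i))) \<in> borel_measurable ?P"
    unfolding measurable_cong_sets[OF sP refl] by (rule hx)
  have cd: "dist (a i) (b i) \<le> config_dist N a b" for a b :: "nat \<Rightarrow> 'a"
    unfolding config_dist_def using i by (intro member_le_sum) auto
  have cd0: "0 \<le> config_dist N a b" for a b :: "nat \<Rightarrow> 'a"
    by (simp add: config_dist_def sum_nonneg)
  have "(\<integral>\<^sup>+y. dist (x i) (y i) \<partial>?P) = (\<integral>\<^sup>+p. dist (x i) (snd p i) \<partial>\<gamma>)"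
    by (rule nn_integral_coupling_snd[symmetric, OF \<gamma> hP])
  also have "\<dots> \<le> (\<integral>\<^sup>+p. ennreal (dist (x i) (fst p i)) + ennreal (config_dist N (fst p) (snd p)) \<partial>\<gamma>)"
    by (intro nn_integral_mono)
      (simp add: cd0 ennreal_leI order_trans[OF dist_triangle add_left_mono[OF cd]] flip: ennreal_plus)
  also have "\<dots> = (\<integral>\<^sup>+p. ennreal (dist (x i) (fst p i)) \<partial>\<gamma>) + (\<integral>\<^sup>+p. config_dist N (fst p) (snd p) \<partial>\<gamma>)"
    unfolding measurable_cong_sets[OF s refl, symmetric]
    by (rule nn_integral_add; unfold measurable_cong_sets[OF s refl])
      (use measurable_config_dist in \<open>auto intro: measurable_compose[OF measurable_fst hx] simp del: borel_measurable_ennreal_iff\<close>)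
  also have "(\<integral>\<^sup>+p. ennreal (dist (x i) (fst p i)) \<partial>\<gamma>) = (\<integral>\<^sup>+y. ennreal (dist (x i) (y i)) \<partial>return C x)"
    by (rule nn_integral_coupling_fst[OF \<gamma>]) (simp only: measurable_return1 hx)
  \<comment> \<open>The first marginal of \<gamma> is the point mass at \<open>x\<close>, so only
    the transport cost remains.\<close>
  also have "\<dots> = 0"
    using x by (subst nn_integral_return[OF _ hx]) auto
  finally have "(\<integral>\<^sup>+y. dist (x i) (y i) \<partial>partial_scan N (return C x)) < \<top>"
    using cost by (simp add: P)
  then have fin: "(\<integral>\<^sup>+z. \<integral>\<^sup>+a. dist (x i) a \<partial>K i (drop_coord N i z) \<partial>partial_scan i (return C x)) < \<top>"
    using i by (subst (asm) nn_integral_component_partial_scan[OF r i]) auto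
  let ?m = "partial_scan i (return C x)"
  have m: "prob_space ?m" "space ?m = space C"
    using partial_scan_in[OF r, of i] i by (auto simp: space_prob_algebra dest: sets_eq_imp_space_eq)
  \<comment> \<open>Otherwise the integrand would be infinite everywhere, and so would its integral
    against a probability measure.\<close>
  have "\<exists>z\<in>space C. (\<integral>\<^sup>+a. dist (x i) a \<partial>K i (drop_coord N i z)) < \<top>"
  proof (rule ccontr)
    assume "\<not> ?thesis"
    then have "(\<integral>\<^sup>+z. \<integral>\<^sup>+a. dist (x i) a \<partial>K i (drop_coord N i z) \<partial>?m) = (\<integral>\<^sup>+z. \<top> \<partial>?m)"
      by (intro nn_integral_cong) (auto simp: m not_less top_unique)
    with fin m(1) show False
      by (simp add: prob_space.emeasure_space_1)
  qed
  then obtain z where z: "z \<in> space C" "(\<integral>\<^sup>+a. dist (x i) a \<partial>K i (drop_coord N i z)) < \<top>" ..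
  have "wasserstein1 dist (K i (drop_coord N i z)) (K i (drop_coord N i y)) < \<top>"
  proof (rule le_less_trans)
    show "wasserstein1 dist (K i (drop_coord N i z)) (K i (drop_coord N i y))
        \<le> ennreal (\<Sum>j<N. A $$ (i, j) * dist (z j) (y j))"
      using A z(1) y i by (simp add: dobrushin_matrix_def)
  qed simp
  then show ?thesis
    using z y i by (intro nn_integral_dist_coupling_finite[OF _ _ _ z(2)] sets_coordinate_kernel)
qed

end

subsection \<open>Contraction of coordinatewise distances\<close>

lemma update_matrix_mult_vec:
  assumes v: "v \<in> carrier_vec N" and i: "i < N"
  shows "update_matrix N A i *\<^sub>v v \<in> carrier_vec N"
    and "j < N \<Longrightarrow> vec_index (update_matrix N A i *\<^sub>v v) j
           = (if j = i then \<Sum>l<N. A $$ (i, l) * vec_index v l else vec_index v j)"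
proof -
  show "update_matrix N A i *\<^sub>v v \<in> carrier_vec N"
    by (rule carrier_vecI) (simp add: update_matrix_def)
  assume j: "j < N"
  have "vec_index (update_matrix N A i *\<^sub>v v) j
      = (\<Sum>l<N. (if j = i then A $$ (i, l) else if j = l then 1 else 0) * vec_index v l)"
    using v j by (auto simp: update_matrix_def scalar_prod_def lessThan_atLeast0 intro!: sum.cong)
  also have "\<dots> = (if j = i then \<Sum>l<N. A $$ (i, l) * vec_index v l else vec_index v j)"
    using j by (simp add: if_distrib[of "\<lambda>x. x * _"] cong: if_cong)
  finally show "vec_index (update_matrix N A i *\<^sub>v v) j = \<dots>" .
qed

context glauber_kernels
begin

text \<open>A single coupling has to serve all coordinates simultaneously, so that the bounds can
  later be combined linearly and summed. The slack \<epsilon> leaves room for couplings that are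
  only near-optimal.\<close>

definition coupled :: "(nat \<Rightarrow> 'a) measure \<Rightarrow> (nat \<Rightarrow> 'a) measure \<Rightarrow> real vec \<Rightarrow> bool" where
  "coupled m m' v \<longleftrightarrow> v \<in> carrier_vec N \<and> (\<forall>j<N. 0 \<le> vec_index v j) \<and>
     (\<forall>\<epsilon>>0. \<exists>\<gamma>\<in>couplings m m'. \<forall>j<N.
        (\<integral>\<^sup>+p. dist (fst p j) (snd p j) \<partial>\<gamma>) \<le> ennreal (vec_index v j + \<epsilon>))"

lemma coupled_return:
  assumes x: "x \<in> space C" and y: "y \<in> space C"
  shows "coupled (return C x) (return C y) (vec N (\<lambda>j. dist (x j) (y j)))"
  unfolding coupled_def
proof (intro conjI allI impI)
  fix \<epsilon> :: real assume \<epsilon>: "0 < \<epsilon>"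
  let ?\<gamma> = "return (C \<Otimes>\<^sub>M C) (x, y)"
  have xy: "(x, y) \<in> space (C \<Otimes>\<^sub>M C)" using x y by (simp add: space_pair_measure)
  have "?\<gamma> \<in> couplings (return C x) (return C y)"
    using xy by (simp add: couplings_iff[of _ C _ C] distr_return)
  moreover have "(\<integral>\<^sup>+p. dist (fst p j) (snd p j) \<partial>?\<gamma>) \<le> ennreal (vec_index (vec N (\<lambda>j. dist (x j) (y j))) j + \<epsilon>)"
    if "j < N" for j
    using that xy \<epsilon> by (subst nn_integral_return) (auto intro!: ennreal_leI)
  ultimately show "\<exists>\<gamma>\<in>couplings (return C x) (return C y). \<forall>j<N.
      (\<integral>\<^sup>+p. dist (fst p j) (snd p j) \<partial>\<gamma>) \<le> ennreal (vec_index (vec N (\<lambda>j. dist (x j) (y j))) j + \<epsilon>)"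
    by blast
qed auto

text \<open>Given the current pair of states, both copies of coordinate \<open>i\<close> are drawn
  from a measurably selected near-optimal coupling of the two conditional distributions. The
  Dobrushin condition bounds the new expected distance at \<open>i\<close> linearly in the old ones;
  the other coordinates keep theirs.\<close>

lemma coupled_glauber_update:
  assumes A: "dobrushin_matrix N K A"
    and moment: "\<And>x. x \<in> space C \<Longrightarrow> (\<integral>\<^sup>+a. dist o' a \<partial>K i (drop_coord N i x)) < \<top>"
    and m: "m \<in> space (prob_algebra C)" and m': "m' \<in> space (prob_algebra C)"
    and v: "coupled m m' v" and i: "i < N"
  shows "coupled (m \<bind> G i) (m' \<bind> G i) (update_matrix N A i *\<^sub>v v)"
proof -
  have vN: "v \<in> carrier_vec N" and v0: "\<And>j. j < N \<Longrightarrow> 0 \<le> vec_index v j"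
    using v by (auto simp: coupled_def)
  have A0: "\<And>j. j < N \<Longrightarrow> 0 \<le> A $$ (i, j)"
    and AW: "\<And>x y. x \<in> space C \<Longrightarrow> y \<in> space C \<Longrightarrow>
      wasserstein1 dist (K i (drop_coord N i x)) (K i (drop_coord N i y))
          \<le> ennreal (\<Sum>j<N. A $$ (i, j) * dist (x j) (y j))"
    using A i by (auto simp: dobrushin_matrix_def)
  let ?w = "update_matrix N A i *\<^sub>v v"
  note w = update_matrix_mult_vec[OF vN i, where A=A]
  have "\<exists>\<gamma>\<in>couplings (m \<bind> G i) (m' \<bind> G i). \<forall>j<N.
      (\<integral>\<^sup>+p. dist (fst p j) (snd p j) \<partial>\<gamma>) \<le> ennreal (vec_index ?w j + \<epsilon>)" if \<epsilon>: "0 < \<epsilon>" for \<epsilon> :: real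
  proof -
    define s where "s = (\<Sum>j<N. A $$ (i, j))"
    have s: "0 \<le> s" unfolding s_def using A0 by (intro sum_nonneg) auto
    \<comment> \<open>The old slack enters the new entry \<open>i\<close> multiplied by the row sum
      \<open>s\<close>. This choice makes \<open>s * \<epsilon>'\<close> at most
      \<open>\<epsilon> / 2\<close>, and the other half is left for the error of the selected
      couplings; adding 1 to \<open>s\<close> avoids division by zero.\<close>
    define \<epsilon>' where "\<epsilon>' = \<epsilon> / (2 * (1 + s))"
    have \<epsilon>': "0 < \<epsilon>'" "\<epsilon>' \<le> \<epsilon>" "s * \<epsilon>' + \<epsilon> / 2 \<le> \<epsilon>"
      using \<epsilon> s by (auto simp: \<epsilon>'_def field_simps)
    obtain \<gamma> where \<gamma>: "\<gamma> \<in> couplings m m'"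
      and cost: "\<And>j. j < N \<Longrightarrow> (\<integral>\<^sup>+p. dist (fst p j) (snd p j) \<partial>\<gamma>) \<le> ennreal (vec_index v j + \<epsilon>')"
      using v \<epsilon>'(1) unfolding coupled_def by blast
    have sm: "sets m = sets C" "sets m' = sets C" and pm: "prob_space m"
      using m m' by (auto simp: space_prob_algebra)
    have s\<gamma>: "sets \<gamma> = sets (C \<Otimes>\<^sub>M C)" and d1: "distr \<gamma> C fst = m" and d2: "distr \<gamma> C snd = m'"
      using \<gamma> couplings_iff[OF sm] by auto
    have p\<gamma>: "\<gamma> \<in> space (prob_algebra (C \<Otimes>\<^sub>M C))"
      using s\<gamma> couplings_prob_space[OF \<gamma> pm] by (simp add: space_prob_algebra)
    have ne: "space \<gamma> \<noteq> {}"
      using p\<gamma> by (auto simp: space_prob_algebra dest: prob_space.not_empty)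
    have sp: "space \<gamma> = space C \<times> space C"
      using sets_eq_imp_space_eq[OF s\<gamma>] by (simp add: space_pair_measure)
    note cong_\<gamma> = measurable_cong_sets[OF s\<gamma> refl]
    let ?c = "\<lambda>z. ennreal (\<Sum>j<N. A $$ (i, j) * dist (fst z j) (snd z j))"
    have cm: "?c \<in> borel_measurable (C \<Otimes>\<^sub>M C)"
      by (intro measurable_compose[OF _ measurable_ennreal] borel_measurable_sum borel_measurable_times
          borel_measurable_const measurable_dist_component) simp
    obtain Q where Qm: "Q \<in> C \<Otimes>\<^sub>M C \<rightarrow>\<^sub>M prob_algebra (borel \<Otimes>\<^sub>M borel)"
      and Qc: "\<And>z. z \<in> space (C \<Otimes>\<^sub>M C) \<Longrightarrow>
        Q z \<in> couplings (K i (drop_coord N i (fst z))) (K i (drop_coord N i (snd z)))"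
      and Qd: "\<And>z. z \<in> space (C \<Otimes>\<^sub>M C) \<Longrightarrow>
        (\<integral>\<^sup>+p. dist (fst p) (snd p) \<partial>Q z) \<le> ?c z + ennreal (\<epsilon> / 2)"
      by (rule near_optimal_coupling_kernel[of "\<lambda>z. K i (drop_coord N i (fst z))" "C \<Otimes>\<^sub>M C"
              "\<lambda>z. K i (drop_coord N i (snd z))" ?c o' "\<epsilon> / 2"])
        (use \<epsilon> i in \<open>auto simp: space_pair_measure intro: AW moment cm
            measurable_compose[OF measurable_fst measurable_coordinate_kernel]
            measurable_compose[OF measurable_snd measurable_coordinate_kernel]\<close>)
    have sQ: "sets (Q z) = sets (borel \<Otimes>\<^sub>M borel)" and pQ: "prob_space (Q z)"
      if "z \<in> space (C \<Otimes>\<^sub>M C)" for z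
      using measurable_space[OF Qm that] by (auto simp: space_prob_algebra)
    let ?u = "\<lambda>z p. ((fst z)(i := fst p), (snd z)(i := snd p))"
    \<comment> \<open>The joint update kernel: both states receive their new coordinate
      \<open>i\<close> from one draw of \<open>Q z\<close>.\<close>
    define R where "R z = distr (Q z) (C \<Otimes>\<^sub>M C) (?u z)" for z
    have u1: "(\<lambda>x. (fst (fst x))(i := fst (snd x))) \<in> (C \<Otimes>\<^sub>M C) \<Otimes>\<^sub>M (borel \<Otimes>\<^sub>M borel) \<rightarrow>\<^sub>M C"
      using measurable_compose[OF _ measurable_fun_upd_config[OF i],
          of "\<lambda>x. (fst (fst x), fst (snd x))" "(C \<Otimes>\<^sub>M C) \<Otimes>\<^sub>M (borel \<Otimes>\<^sub>M borel)"] by simp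
    have u2: "(\<lambda>x. (snd (fst x))(i := snd (snd x))) \<in> (C \<Otimes>\<^sub>M C) \<Otimes>\<^sub>M (borel \<Otimes>\<^sub>M borel) \<rightarrow>\<^sub>M C"
      using measurable_compose[OF _ measurable_fun_upd_config[OF i],
          of "\<lambda>x. (snd (fst x), snd (snd x))" "(C \<Otimes>\<^sub>M C) \<Otimes>\<^sub>M (borel \<Otimes>\<^sub>M borel)"] by simp
    have um: "(\<lambda>(z, p). ?u z p) \<in> (C \<Otimes>\<^sub>M C) \<Otimes>\<^sub>M (borel \<Otimes>\<^sub>M borel) \<rightarrow>\<^sub>M C \<Otimes>\<^sub>M C"
      unfolding case_prod_beta' by (rule measurable_Pair[OF u1 u2])
    have uz: "?u z \<in> Q z \<rightarrow>\<^sub>M C \<Otimes>\<^sub>M C" if "z \<in> space (C \<Otimes>\<^sub>M C)" for z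
      using measurable_Pair2[OF um that] by (simp add: measurable_cong_sets[OF sQ[OF that] refl])
    have Rm: "R \<in> C \<Otimes>\<^sub>M C \<rightarrow>\<^sub>M prob_algebra (C \<Otimes>\<^sub>M C)"
      unfolding R_def[abs_def] by (rule measurable_distr_prob_space2[OF Qm um])
    have Rs: "R \<in> \<gamma> \<rightarrow>\<^sub>M subprob_algebra (C \<Otimes>\<^sub>M C)"
      using measurable_prob_algebraD[OF Rm] by (simp add: cong_\<gamma>)
    \<comment> \<open>The marginals of the joint update are the ordinary updates of the two states,
      so \<open>\<gamma> \<bind> R\<close> couples the updated laws.\<close>
    have R1: "distr (R z) C fst = G i (fst z)" and R2: "distr (R z) C snd = G i (snd z)"
      if z: "z \<in> space (C \<Otimes>\<^sub>M C)" for z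
    proof -
      have zC: "fst z \<in> space C" "snd z \<in> space C" using z by (auto simp: space_pair_measure)
      have q: "distr (Q z) borel fst = K i (drop_coord N i (fst z))"
        "distr (Q z) borel snd = K i (drop_coord N i (snd z))"
        using Qc[OF z] couplings_iff[OF sets_coordinate_kernel[OF i zC(1)] sets_coordinate_kernel[OF i zC(2)]] by auto
      have f: "fst \<in> Q z \<rightarrow>\<^sub>M borel" "snd \<in> Q z \<rightarrow>\<^sub>M borel"
        by (simp_all add: measurable_cong_sets[OF sQ[OF z] refl])
      show "distr (R z) C fst = G i (fst z)"
        unfolding R_def glauber_update_def q(1)[symmetric]
        using uz[OF z] measurable_fun_upd_config1[OF i zC(1)] f by (simp add: distr_distr comp_def)
      show "distr (R z) C snd = G i (snd z)"
        unfolding R_def glauber_update_def q(2)[symmetric]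
        using uz[OF z] measurable_fun_upd_config1[OF i zC(2)] f by (simp add: distr_distr comp_def)
    qed
    have "distr (\<gamma> \<bind> R) C fst = \<gamma> \<bind> (\<lambda>z. G i (fst z))"
      by (subst distr_bind[OF Rs ne measurable_fst])
        (intro bind_cong refl R1, simp add: sp space_pair_measure)
    also have "\<dots> = m \<bind> G i"
      unfolding d1[symmetric] using ne
      by (intro bind_distr[symmetric, OF _ measurable_glauber_update'[OF i]]) (simp_all add: cong_\<gamma>)
    finally have b1: "distr (\<gamma> \<bind> R) C fst = m \<bind> G i" .
    have "distr (\<gamma> \<bind> R) C snd = \<gamma> \<bind> (\<lambda>z. G i (snd z))"
      by (subst distr_bind[OF Rs ne measurable_snd])
        (intro bind_cong refl R2, simp add: sp space_pair_measure)
    also have "\<dots> = m' \<bind> G i"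
      unfolding d2[symmetric] using ne
      by (intro bind_distr[symmetric, OF _ measurable_glauber_update'[OF i]]) (simp_all add: cong_\<gamma>)
    finally have b2: "distr (\<gamma> \<bind> R) C snd = m' \<bind> G i" .
    have sb: "sets (m \<bind> G i) = sets C" "sets (m' \<bind> G i) = sets C"
      using m m' by (simp_all add: sets_bind'[OF _ measurable_glauber_update[OF i]])
    have "\<gamma> \<bind> R \<in> couplings (m \<bind> G i) (m' \<bind> G i)"
      unfolding couplings_iff[OF sb] using b1 b2 sets_bind'[OF p\<gamma> Rm] by simp
    moreover have "(\<integral>\<^sup>+p. dist (fst p j) (snd p j) \<partial>(\<gamma> \<bind> R)) \<le> ennreal (vec_index ?w j + \<epsilon>)" if j: "j < N" for j
    proof -
      have dm: "(\<lambda>p. ennreal (dist (fst p j) (snd p j))) \<in> borel_measurable (C \<Otimes>\<^sub>M C)"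
        using measurable_dist_component[OF j] by simp
      have eq: "(\<integral>\<^sup>+p. dist (fst p j) (snd p j) \<partial>(\<gamma> \<bind> R))
          = (\<integral>\<^sup>+z. \<integral>\<^sup>+p. dist (fst (?u z p) j) (snd (?u z p) j) \<partial>Q z \<partial>\<gamma>)"
        unfolding nn_integral_bind[OF dm Rs] R_def
        by (rule nn_integral_cong, rule nn_integral_distr[OF uz]) (use dm in \<open>auto simp: sp space_pair_measure\<close>)
      show ?thesis
      proof (cases "j = i")
        case False
        \<comment> \<open>Away from \<open>i\<close> the inner integrand is constant in the draw,
          and \<open>Q z\<close> has mass 1.\<close>
        have "(\<integral>\<^sup>+z. \<integral>\<^sup>+p. dist (fst (?u z p) j) (snd (?u z p) j) \<partial>Q z \<partial>\<gamma>)
            = (\<integral>\<^sup>+z. dist (fst z j) (snd z j) \<partial>\<gamma>)"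
          using False pQ by (intro nn_integral_cong)
            (auto simp: sp space_pair_measure prob_space.emeasure_space_1)
        also have "\<dots> \<le> ennreal (vec_index v j + \<epsilon>')" by (rule cost[OF j])
        also have "\<dots> \<le> ennreal (vec_index ?w j + \<epsilon>)"
          using \<epsilon>' False j by (intro ennreal_leI) (simp add: w(2))
        finally show ?thesis unfolding eq .
      next
        case True
        have "(\<integral>\<^sup>+z. \<integral>\<^sup>+p. dist (fst (?u z p) j) (snd (?u z p) j) \<partial>Q z \<partial>\<gamma>)
            \<le> (\<integral>\<^sup>+z. ?c z + ennreal (\<epsilon> / 2) \<partial>\<gamma>)"
          using True Qd by (intro nn_integral_mono) (auto simp: sp space_pair_measure)
        also have "\<dots> = (\<integral>\<^sup>+z. ?c z \<partial>\<gamma>) + ennreal (\<epsilon> / 2)"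
          using p\<gamma> cm by (subst nn_integral_add)
            (auto simp: cong_\<gamma> space_prob_algebra prob_space.emeasure_space_1)
        also have "(\<integral>\<^sup>+z. ?c z \<partial>\<gamma>) = (\<integral>\<^sup>+z. (\<Sum>l<N. ennreal (A $$ (i, l)) * ennreal (dist (fst z l) (snd z l))) \<partial>\<gamma>)"
          by (intro nn_integral_cong, subst sum_ennreal[symmetric]) (auto simp: A0 ennreal_mult)
        also have "\<dots> = (\<Sum>l<N. \<integral>\<^sup>+z. ennreal (A $$ (i, l)) * ennreal (dist (fst z l) (snd z l)) \<partial>\<gamma>)"
          by (intro nn_integral_sum borel_measurable_times_ennreal borel_measurable_const
              measurable_compose[OF _ measurable_ennreal]) (simp add: cong_\<gamma> measurable_dist_component)
        also have "\<dots> = (\<Sum>l<N. ennreal (A $$ (i, l)) * (\<integral>\<^sup>+z. dist (fst z l) (snd z l) \<partial>\<gamma>))"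
          by (intro sum.cong refl nn_integral_cmult
              measurable_compose[OF _ measurable_ennreal]) (simp add: cong_\<gamma> measurable_dist_component)
        also have "\<dots> \<le> (\<Sum>l<N. ennreal (A $$ (i, l)) * ennreal (vec_index v l + \<epsilon>'))"
          by (intro sum_mono mult_left_mono cost) auto
        also have "\<dots> = ennreal (\<Sum>l<N. A $$ (i, l) * (vec_index v l + \<epsilon>'))"
          using A0 v0 \<epsilon>'(1) by (subst sum_ennreal[symmetric]) (auto simp: ennreal_mult)
        also have "(\<Sum>l<N. A $$ (i, l) * (vec_index v l + \<epsilon>')) = vec_index ?w i + s * \<epsilon>'"
          using i by (simp add: w(2) s_def distrib_left sum.distrib sum_distrib_right)
        also have "ennreal (vec_index ?w i + s * \<epsilon>') + ennreal (\<epsilon> / 2) \<le> ennreal (vec_index ?w i + \<epsilon>)"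
        proof -
          have "0 \<le> vec_index ?w i"
            using i A0 v0 by (auto simp: w(2) intro!: sum_nonneg)
          then have "ennreal (vec_index ?w i + s * \<epsilon>') + ennreal (\<epsilon> / 2)
              = ennreal (vec_index ?w i + s * \<epsilon>' + \<epsilon> / 2)"
            using \<epsilon>'(1) s \<epsilon> by (intro ennreal_plus[symmetric]) auto
          then show ?thesis
            using \<epsilon>'(3) by (simp only:) (intro ennreal_leI, linarith)
        qed
        finally show ?thesis unfolding eq using True by simp
      qed
    qed
    ultimately show ?thesis by blast
  qed
  then show ?thesis
    unfolding coupled_def using w v0 A0 by (auto intro!: sum_nonneg)
qed

text \<open>The metric is the sum of the coordinate distances, so the cost of one common coupling is
  at most the sum of the entries plus \<open>N\<close> times the slack.\<close>

lemma coupled_wasserstein1: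
  assumes v: "coupled m m' v" and m: "m \<in> space (prob_algebra C)" "m' \<in> space (prob_algebra C)"
  shows "wasserstein1 (config_dist N) m m' \<le> ennreal (vec_norm1 v)"
proof (rule ennreal_le_epsilon)
  fix \<epsilon> :: real assume \<epsilon>: "0 < \<epsilon>"
  define \<epsilon>' where "\<epsilon>' = \<epsilon> / (1 + real N)"
  have \<epsilon>': "0 < \<epsilon>'" "real N * \<epsilon>' \<le> \<epsilon>" using \<epsilon> by (auto simp: \<epsilon>'_def field_simps)
  obtain \<gamma> where \<gamma>: "\<gamma> \<in> couplings m m'"
    and cost: "\<And>j. j < N \<Longrightarrow> (\<integral>\<^sup>+p. dist (fst p j) (snd p j) \<partial>\<gamma>) \<le> ennreal (vec_index v j + \<epsilon>')"
    using v \<epsilon>'(1) unfolding coupled_def by blast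
  have vN: "v \<in> carrier_vec N" and v0: "\<And>j. j < N \<Longrightarrow> 0 \<le> vec_index v j"
    using v by (auto simp: coupled_def)
  have s\<gamma>: "sets \<gamma> = sets (C \<Otimes>\<^sub>M C)"
    using \<gamma> couplings_iff[of m C m' C] m by (auto simp: space_prob_algebra)
  have "wasserstein1 (config_dist N) m m' \<le> (\<integral>\<^sup>+p. config_dist N (fst p) (snd p) \<partial>\<gamma>)"
    unfolding wasserstein1_def by (rule INF_lower[OF \<gamma>])
  also have "\<dots> = (\<integral>\<^sup>+p. (\<Sum>j<N. ennreal (dist (fst p j) (snd p j))) \<partial>\<gamma>)"
    by (simp add: config_dist_def)
  also have "\<dots> = (\<Sum>j<N. \<integral>\<^sup>+p. dist (fst p j) (snd p j) \<partial>\<gamma>)"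
    by (intro nn_integral_sum measurable_compose[OF _ measurable_ennreal])
      (simp add: measurable_cong_sets[OF s\<gamma> refl] measurable_dist_component)
  also have "\<dots> \<le> (\<Sum>j<N. ennreal (vec_index v j + \<epsilon>'))"
    by (intro sum_mono cost) simp
  also have "\<dots> = ennreal (\<Sum>j<N. vec_index v j + \<epsilon>')"
    using v0 \<epsilon>'(1) by (intro sum_ennreal) (auto intro: add_nonneg_nonneg)
  also have "\<dots> \<le> ennreal (vec_norm1 v + \<epsilon>)"
    using vN v0 \<epsilon>'(2) by (intro ennreal_leI) (simp add: vec_norm1_def sum.distrib)
  also have "\<dots> = ennreal (vec_norm1 v) + ennreal \<epsilon>"
    using \<epsilon> by (intro ennreal_plus) (auto simp: vec_norm1_def sum_nonneg)
  finally show "wasserstein1 (config_dist N) m m' \<le> ennreal (vec_norm1 v) + ennreal \<epsilon>" .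
qed

end

section \<open>The induced matrix norm and the scan matrix\<close>

lemma mat_norm1_nonneg: "0 \<le> mat_norm1 A"
\<comment> \<open>The formula by column sums requires a column. Without columns the unit ball
  consists of the empty vector alone.\<close>
proof (cases "dim_col A = 0")
  case True
  have "{v \<in> carrier_vec (dim_col A). vec_norm1 v \<le> 1} = {0\<^sub>v 0}"
    using True by (auto simp: vec_norm1_def)
  then show ?thesis
    by (simp add: mat_norm1_def vec_norm1_def sum_nonneg)
next
  case False
  then have A: "0 < dim_col A" by simp
  have "0 \<le> (\<Sum>i<dim_row A. \<bar>A $$ (i, 0)\<bar>)" by (simp add: sum_nonneg)
  also have "\<dots> \<le> mat_norm1 A"
    unfolding mat_norm1_eq_Max_col_sum[OF A] using A by (intro Max_ge) auto
  finally show ?thesis .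
qed

lemma vec_norm1_mult_le_mat_norm1:
  assumes v: "v \<in> carrier_vec (dim_col A)"
  shows "vec_norm1 (A *\<^sub>v v) \<le> mat_norm1 A * vec_norm1 v"
proof (cases "dim_col A = 0")
  case True
  then show ?thesis using v vec_norm1_mult_mat_vec[OF v] by (simp add: vec_norm1_def)
next
  case False
  then have A: "0 < dim_col A" by simp
  have "vec_norm1 (A *\<^sub>v v) \<le> (\<Sum>j<dim_col A. (\<Sum>i<dim_row A. \<bar>A $$ (i, j)\<bar>) * \<bar>vec_index v j\<bar>)"
    by (rule vec_norm1_mult_mat_vec[OF v])
  also have "\<dots> \<le> (\<Sum>j<dim_col A. mat_norm1 A * \<bar>vec_index v j\<bar>)"
    unfolding mat_norm1_eq_Max_col_sum[OF A] by (intro sum_mono mult_right_mono Max_ge) auto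
  also have "\<dots> = mat_norm1 A * vec_norm1 v"
    using v by (simp add: vec_norm1_def sum_distrib_left)
  finally show ?thesis .
qed

lemma update_matrix_carrier[simp]: "update_matrix N A i \<in> carrier_mat N N"
  by (simp add: update_matrix_def)

lemma foldl_update_matrix_carrier:
  "foldl (\<lambda>M i. update_matrix N A i * M) (1\<^sub>m N) is \<in> carrier_mat N N"
  by (induction "is" rule: rev_induct) (simp_all add: mult_carrier_mat[OF update_matrix_carrier])

lemma scan_matrix_carrier: "scan_matrix N A \<in> carrier_mat N N"
  unfolding scan_matrix_def by (rule foldl_update_matrix_carrier)

text \<open>Matrix powers are defined by multiplication on the right, while each new sweep acts on
  the distance vector from the left.\<close>

lemma pow_mat_Suc_left:
  fixes B :: "'b::semiring_1 mat"
  assumes B: "B \<in> carrier_mat n n"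
  shows "B ^\<^sub>m Suc k = B * B ^\<^sub>m k"
proof (induction k)
  case 0
  show ?case using B by simp
next
  case (Suc k)
  have "B ^\<^sub>m Suc (Suc k) = B * B ^\<^sub>m k * B"
    unfolding pow_mat.simps(2)[of B "Suc k"] Suc ..
  also have "\<dots> = B * (B ^\<^sub>m k * B)"
    by (rule assoc_mult_mat[OF B pow_carrier_mat[OF B] B])
  finally show ?case by simp
qed

section \<open>Iteration over sweeps and the curvature bound\<close>

context glauber_kernels
begin

text \<open>Each update puts its matrix to the left of the earlier ones, in the same order as in
  \<open>scan_matrix\<close>. The reference point \<open>o' i\<close> of the moment condition may
  depend on the coordinate.\<close>

lemma coupled_partial_scan:
  assumes A: "dobrushin_matrix N K A"
    and moment: "\<And>i x. i < N \<Longrightarrow> x \<in> space C \<Longrightarrow> (\<integral>\<^sup>+a. dist (o' i) a \<partial>K i (drop_coord N i x)) < \<top>"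
    and m: "m \<in> space (prob_algebra C)" and m': "m' \<in> space (prob_algebra C)"
    and v: "coupled m m' v"
  shows "n \<le> N \<Longrightarrow> coupled (partial_scan n m) (partial_scan n m')
           (foldl (\<lambda>M i. update_matrix N A i * M) (1\<^sub>m N) [0..<n] *\<^sub>v v)"
proof (induction n)
  case 0
  then show ?case using v one_mult_mat_vec[of v N] by (simp add: coupled_def del: ennreal_plus)
next
  case (Suc n)
  have vN: "v \<in> carrier_vec N" using v by (simp add: coupled_def)
  have "coupled (partial_scan n m \<bind> G n) (partial_scan n m' \<bind> G n)
      (update_matrix N A n *\<^sub>v (foldl (\<lambda>M i. update_matrix N A i * M) (1\<^sub>m N) [0..<n] *\<^sub>v v))"
    using Suc by (intro coupled_glauber_update[OF A moment] partial_scan_in m m') auto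
  then show ?case
    by (simp add: assoc_mult_mat_vec[OF update_matrix_carrier foldl_update_matrix_carrier vN])
qed

lemma kernel_power_in: "x \<in> space C \<Longrightarrow> kernel_power C (systemic_scan N K) k x \<in> space (prob_algebra C)"
  by (induction k)
    (simp_all add: space_prob_algebra prob_space_return bind_in_prob_algebra[OF _ measurable_systemic_scan, unfolded space_prob_algebra, simplified])

text \<open>The start is the exact vector of coordinate distances of \<open>x\<close> and
  \<open>y\<close>, and every step of the chain is a full scan of the current law, contributing one
  more factor of the scan matrix.\<close>

lemma coupled_kernel_power:
  assumes A: "dobrushin_matrix N K A"
    and moment: "\<And>i x. i < N \<Longrightarrow> x \<in> space C \<Longrightarrow> (\<integral>\<^sup>+a. dist (o' i) a \<partial>K i (drop_coord N i x)) < \<top>"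
    and x: "x \<in> space C" and y: "y \<in> space C"
  shows "coupled (kernel_power C (systemic_scan N K) k x) (kernel_power C (systemic_scan N K) k y)
           (scan_matrix N A ^\<^sub>m k *\<^sub>v vec N (\<lambda>j. dist (x j) (y j)))"
proof (induction k)
  case 0
  have "dim_row (scan_matrix N A) = N" using scan_matrix_carrier[of N A] by simp
  then show ?case using coupled_return[OF x y] by simp
next
  case (Suc k)
  let ?B = "scan_matrix N A" and ?d = "vec N (\<lambda>j. dist (x j) (y j))"
  have "?B ^\<^sub>m Suc k = ?B * ?B ^\<^sub>m k"
    by (rule pow_mat_Suc_left[OF scan_matrix_carrier])
  then have "?B ^\<^sub>m Suc k *\<^sub>v ?d = ?B *\<^sub>v (?B ^\<^sub>m k *\<^sub>v ?d)"
    using scan_matrix_carrier[of N A] by (simp add: assoc_mult_mat_vec[of _ N N _ N])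
  moreover have "coupled (partial_scan N (kernel_power C (systemic_scan N K) k x))
      (partial_scan N (kernel_power C (systemic_scan N K) k y)) (?B *\<^sub>v (?B ^\<^sub>m k *\<^sub>v ?d))"
    unfolding scan_matrix_def[of N A]
    using Suc[unfolded scan_matrix_def[of N A]]
    by (intro coupled_partial_scan[OF A moment] kernel_power_in x y) auto
  ultimately show ?case
    using kernel_power_in[OF x] kernel_power_in[OF y] by (simp add: bind_systemic_scan)
qed

lemma curvature_at_ge:
  assumes A: "dobrushin_matrix N K A"
    and moment: "\<And>i x. i < N \<Longrightarrow> x \<in> space C \<Longrightarrow> (\<integral>\<^sup>+a. dist (o' i) a \<partial>K i (drop_coord N i x)) < \<top>"
    and x: "x \<in> space C" and y: "y \<in> space C"
  shows "ereal (1 - mat_norm1 (scan_matrix N A ^\<^sub>m k))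
           \<le> curvature_at C (config_dist N) (systemic_scan N K) k x y"
proof (cases "x = y")
  case True
  \<comment> \<open>On the diagonal the curvature is 1 by definition, and the norm is
    nonnegative.\<close>
  then show ?thesis by (simp add: curvature_at_def mat_norm1_nonneg)
next
  case False
  let ?b = "mat_norm1 (scan_matrix N A ^\<^sub>m k)" and ?d = "vec N (\<lambda>j. dist (x j) (y j))"
  let ?W = "wasserstein1 (config_dist N) (kernel_power C (systemic_scan N K) k x)
    (kernel_power C (systemic_scan N K) k y)"
  have dc: "dim_col (scan_matrix N A ^\<^sub>m k) = N"
    by (rule carrier_matD(2)[OF pow_carrier_mat[OF scan_matrix_carrier]])
  \<comment> \<open>Configurations are extensional, so distinct ones differ at some index below
    \<open>N\<close>; this makes their distance positive and the later division legitimate.\<close>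
  have "\<exists>j<N. x j \<noteq> y j"
    using False x y unfolding config_def space_PiM by (metis PiE_ext lessThan_iff)
  then obtain j where j: "j < N" "x j \<noteq> y j" by blast
  then have "0 < dist (x j) (y j)" by simp
  also have "\<dots> \<le> config_dist N x y"
    unfolding config_dist_def using j by (intro member_le_sum) auto
  finally have pos: "0 < config_dist N x y" .
  have "?W \<le> ennreal (vec_norm1 (scan_matrix N A ^\<^sub>m k *\<^sub>v ?d))"
    by (intro coupled_wasserstein1[OF coupled_kernel_power[OF A moment x y]] kernel_power_in x y)
  also have "\<dots> \<le> ennreal (?b * vec_norm1 ?d)"
    by (intro ennreal_leI vec_norm1_mult_le_mat_norm1, unfold dc) simp
  \<comment> \<open>The metric on configurations is the l1 norm of the vector of coordinate
    distances, which is why the induced l1 norm of the matrix appears.\<close>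
  also have "vec_norm1 ?d = config_dist N x y"
    by (simp add: vec_norm1_def config_dist_def)
  finally have "enn2ereal ?W \<le> ereal (?b * config_dist N x y)"
    using pos mat_norm1_nonneg[of "scan_matrix N A ^\<^sub>m k"]
    by (metis enn2ereal_ennreal less_eq_ennreal.rep_eq less_imp_le mult_nonneg_nonneg)
  then have "enn2ereal ?W / ereal (config_dist N x y) \<le> ereal ?b"
    using pos by (simp add: ereal_divide_le_pos mult.commute)
  then have "1 - ereal ?b \<le> 1 - enn2ereal ?W / ereal (config_dist N x y)"
    by (intro ereal_minus_mono) auto
  then show ?thesis
    using False by (simp add: curvature_at_def one_ereal_def)
qed

end

theorem proposition4p6:
  fixes N k :: nat
    and \<mu> :: "(nat \<Rightarrow> 'a::polish_space) measure"
    and K :: "nat \<Rightarrow> (nat \<Rightarrow> 'a) \<Rightarrow> 'a measure"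
    and A :: "real mat"
  assumes "\<mu> \<in> space (prob_algebra (config N))"
    and "conditional_distributions N \<mu> K"
    and "dobrushin_matrix N K A"
    and "\<And>x. x \<in> space (config N) \<Longrightarrow>
           wasserstein1 (config_dist N) (return (config N) x) (systemic_scan N K x) < \<infinity>"
    and "k \<ge> 1"
  shows "curvature (config N) (config_dist N) (systemic_scan N K) k
           \<ge> ereal (1 - mat_norm1 (scan_matrix N A ^\<^sub>m k))"
proof -
  interpret glauber_kernels N K
    using assms(2) by unfold_locales (simp add: conditional_distributions_def)
  have "ereal (1 - mat_norm1 (scan_matrix N A ^\<^sub>m k))
      \<le> curvature_at (config N) (config_dist N) (systemic_scan N K) k x y"
    if x: "x \<in> space (config N)" and y: "y \<in> space (config N)" for x y
  \<comment> \<open>The coordinates of \<open>x\<close> serve as the reference points of the first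
    moments.\<close>
  proof (rule curvature_at_ge[OF assms(3) _ x y])
    show "(\<integral>\<^sup>+a. dist (x i) a \<partial>K i (drop_coord N i z)) < \<top>" if "i < N" "z \<in> space (config N)" for i z
      using finite_first_moment[OF assms(3) x _ that] assms(4)[OF x] by simp
  qed
  then show ?thesis
    unfolding curvature_def by (intro INF_greatest)
qed

end
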